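(* Let $F$ be an infinite Pythagorean field with $\mathrm{char}(F)\neq 2$, and let $\mathrm{SO}_n=\mathrm{SO}_n(F,q)$ be the special orthogonal group of the Euclidean quadratic form $q(x)=\sum_{j=1}^n x_j^2$ on $F^n$. Let $i\ge 0$ and $n$ be integers with $2i<n$. Then the group $H_i(\mathrm{SO}_n,\mathbb{Z})$ is isomorphic to its own $\sigma$-invariant part $H_i(\mathrm{SO}_n,\mathbb{Z})^{\sigma}$.
   Context: A field $F$ is Pythagorean if the sum of any two squares in $F$ is a square in $F$. Groups are regarded as discrete groups, and $H_i(G,\mathbb{Z})$ is group homology with trivial coefficients. For $n\ge 1$, $\sigma$ is the involution of $H_i(\mathrm{SO}_n,\mathbb{Z})$ induced by the automorphism $g\mapsto DgD^{-1}$ of $\mathrm{SO}_n$, where $D=\mathrm{diag}(-1,1,\dots,1)\in \mathrm{O}_n$ (i.e. the action of $\mathbb{Z}/2$ arising from the split extension $1\to\mathrm{SO}_n\to\mathrm{O}_n\xrightarrow{\det}\{\pm1\}\to1$). The $\sigma$-invariant part is $H_i(\mathrm{SO}_n,\mathbb{Z})^\sigma=\{x : \sigma x=x\}$. *)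

theory Defs
  imports
    "HOL-Algebra.Free_Abelian_Groups"
    "HOL-Algebra.Coset"
    "Jordan_Normal_Form.Determinant"
begin

section \<open>Homology of a discrete group with trivial integer coefficients\<close>

text \<open>
  The complex below is the inhomogeneous bar complex, i.e. the coinvariants of the bar
  resolution: \<open>C\<^sub>k\<close> is the free abelian group on the symbols \<open>[g\<^sub>1|\<dots>|g\<^sub>k]\<close>, represented by
  lists of length \<open>k\<close>, and the boundary is
  \<open>\<partial>[g\<^sub>1|\<dots>|g\<^sub>k] = [g\<^sub>2|\<dots>|g\<^sub>k] + (\<Sum>0<j<k. (-1)^j [g\<^sub>1|\<dots>|g\<^sub>j g\<^sub>j\<^sub>+\<^sub>1|\<dots>|g\<^sub>k]) + (-1)^k [g\<^sub>1|\<dots>|g\<^sub>k\<^sub>-\<^sub>1]\<close>.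
\<close>

definition bar_chain_group :: "('g, 'm) monoid_scheme \<Rightarrow> nat \<Rightarrow> ('g list \<Rightarrow>\<^sub>0 int) monoid"
  where "bar_chain_group G k = free_Abelian_group {gs. length gs = k \<and> set gs \<subseteq> carrier G}"

text \<open>List positions start at \<open>0\<close>, so \<open>gs ! (j - 1)\<close> is \<open>g\<^sub>j\<close>.\<close>

definition bar_face :: "('g, 'm) monoid_scheme \<Rightarrow> nat \<Rightarrow> 'g list \<Rightarrow> 'g list"
  where "bar_face G j gs =
    (if j = 0 then tl gs
     else if j = length gs then butlast gs
     else take (j - 1) gs @ [gs ! (j - 1) \<otimes>\<^bsub>G\<^esub> gs ! j] @ drop (j + 1) gs)"

definition bar_boundary ::
    "('g, 'm) monoid_scheme \<Rightarrow> nat \<Rightarrow> ('g list \<Rightarrow>\<^sub>0 int) \<Rightarrow> ('g list \<Rightarrow>\<^sub>0 int)"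
  where "bar_boundary G k c =
    (if k = 0 then 0
     else frag_extend (\<lambda>gs. \<Sum>j\<le>k. frag_cmul ((-1) ^ j) (frag_of (bar_face G j gs))) c)"

definition bar_cycles :: "('g, 'm) monoid_scheme \<Rightarrow> nat \<Rightarrow> ('g list \<Rightarrow>\<^sub>0 int) set"
  where "bar_cycles G k = {c \<in> carrier (bar_chain_group G k). bar_boundary G k c = 0}"

definition bar_boundaries :: "('g, 'm) monoid_scheme \<Rightarrow> nat \<Rightarrow> ('g list \<Rightarrow>\<^sub>0 int) set"
  where "bar_boundaries G k = bar_boundary G (Suc k) ` carrier (bar_chain_group G (Suc k))"

definition group_homology ::
    "('g, 'm) monoid_scheme \<Rightarrow> nat \<Rightarrow> ('g list \<Rightarrow>\<^sub>0 int) set monoid"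
  where "group_homology G k =
    (bar_chain_group G k)\<lparr>carrier := bar_cycles G k\<rparr> Mod bar_boundaries G k"

text \<open>
  Homology classes are cosets of the boundaries. The image of a coset under the chain map
  \<open>[g\<^sub>1|\<dots>|g\<^sub>k] \<mapsto> [f g\<^sub>1|\<dots>|f g\<^sub>k]\<close> is only contained in a coset for \<open>H\<close>; adding the
  boundaries of \<open>H\<close> to it gives that coset.
\<close>

definition group_homology_induced ::
    "('g, 'm) monoid_scheme \<Rightarrow> ('h, 'n) monoid_scheme \<Rightarrow> nat \<Rightarrow> ('g \<Rightarrow> 'h) \<Rightarrow>
     ('g list \<Rightarrow>\<^sub>0 int) set \<Rightarrow> ('h list \<Rightarrow>\<^sub>0 int) set"
  where "group_homology_induced G H k f X =
    bar_boundaries H k <#>\<^bsub>bar_chain_group H k\<^esub> (frag_extend (\<lambda>gs. frag_of (map f gs)) ` X)"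

definition invariant_part :: "('g, 'm) monoid_scheme \<Rightarrow> ('g \<Rightarrow> 'g) \<Rightarrow> ('g, 'm) monoid_scheme"
  where "invariant_part A s = A\<lparr>carrier := {x \<in> carrier A. s x = x}\<rparr>"


section \<open>Orthogonal groups over a field\<close>

definition pythagorean_field :: "'a::field itself \<Rightarrow> bool"
  where "pythagorean_field _ \<longleftrightarrow> (\<forall>x y :: 'a. \<exists>z :: 'a. x\<^sup>2 + y\<^sup>2 = z\<^sup>2)"

definition euclidean_form :: "'a::field vec \<Rightarrow> 'a"
  where "euclidean_form x = (\<Sum>j<dim_vec x. (x $ j)\<^sup>2)"

definition orthogonal_group :: "nat \<Rightarrow> ('a::field vec \<Rightarrow> 'a) \<Rightarrow> 'a mat monoid"
  where "orthogonal_group n q =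
    \<lparr>carrier = {A \<in> carrier_mat n n. invertible_mat A \<and> (\<forall>x \<in> carrier_vec n. q (A *\<^sub>v x) = q x)},
     monoid.mult = (*),
     monoid.one = 1\<^sub>m n\<rparr>"

definition special_orthogonal_group :: "nat \<Rightarrow> ('a::field vec \<Rightarrow> 'a) \<Rightarrow> 'a mat monoid"
  where "special_orthogonal_group n q =
    (orthogonal_group n q)\<lparr>carrier := {A \<in> carrier (orthogonal_group n q). det A = 1}\<rparr>"

abbreviation O_group :: "'a::field itself \<Rightarrow> nat \<Rightarrow> 'a mat monoid"
  where "O_group _ n \<equiv> orthogonal_group n (euclidean_form :: 'a vec \<Rightarrow> 'a)"

abbreviation SO_group :: "'a::field itself \<Rightarrow> nat \<Rightarrow> 'a mat monoid"
  where "SO_group _ n \<equiv> special_orthogonal_group n (euclidean_form :: 'a vec \<Rightarrow> 'a)"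

definition reflection_matrix :: "nat \<Rightarrow> 'a::field mat"
  where "reflection_matrix n =
    mat n n (\<lambda>(i, j). if i = j then (if i = 0 then -1 else 1) else 0)"

definition reflection_conj :: "nat \<Rightarrow> 'a::field mat \<Rightarrow> 'a mat"
  where "reflection_conj n g =
    reflection_matrix n \<otimes>\<^bsub>O_group TYPE('a) n\<^esub> g
      \<otimes>\<^bsub>O_group TYPE('a) n\<^esub> inv\<^bsub>O_group TYPE('a) n\<^esub> reflection_matrix n"

definition sigma ::
    "'a::field itself \<Rightarrow> nat \<Rightarrow> nat \<Rightarrow> ('a mat list \<Rightarrow>\<^sub>0 int) set \<Rightarrow> ('a mat list \<Rightarrow>\<^sub>0 int) set"
  where "sigma _ n i =
    group_homology_induced (SO_group TYPE('a) n) (SO_group TYPE('a) n) i (reflection_conj n)"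

end

theory Submission
  imports Defs
begin

text \<open>
  In fact \<open>\<sigma>\<close> acts as the identity. Write \<open>G = SO\<^sub>n\<close>. If \<open>n\<close> is odd, then \<open>\<sigma>\<close> is induced by the inner
  automorphism of \<open>-D \<in> G\<close>. If \<open>2i + 2 \<le> n\<close>, then every class in \<open>H\<^sub>i(G)\<close> comes from \<open>H\<^sub>i(G; \<int>[S])\<close>,
  where \<open>S\<close> is the set of unit vectors, and on the image of the latter \<open>\<sigma>\<close> is the identity because
  \<open>v \<mapsto> D r\<^sub>v \<in> G\<close>, with \<open>r\<^sub>v\<close> the reflection in \<open>v\<close>, is a natural transformation.

  For surjectivity let \<open>T\<^sub>m\<close> be the set of \<open>m\<close>-tuples of vectors all of whose subtuples are linearly
  independent with nondegenerate span, and \<open>T\<^sub>m\<^sup>+\<close> the set of tuples \<open>(w, t)\<close> with \<open>t \<in> T\<^sub>m\<close> and \<open>w\<close> a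
  unit vector orthogonal to \<open>t\<close>. Forgetting \<open>w\<close> induces \<open>H\<^sub>q(G; \<int>[T\<^sub>m\<^sup>+]) \<rightarrow> H\<^sub>q(G; \<int>[T\<^sub>m])\<close>, which is
  onto for \<open>2q + 2 + m \<le> n\<close> and one-to-one for \<open>2q + 3 + m \<le> n\<close>. Both are shown by induction on \<open>q\<close>
  with the double complex of bar chains on \<open>T\<^sub>m, T\<^sub>m\<^sub>+\<^sub>1, \<dots>\<close>: since \<open>F\<close> is infinite, generic vectors
  make its rows exact, and adjoining an orthogonal unit vector contracts the rows of its
  homology in lower degrees. A nonisotropic vector can be normalised as \<open>F\<close> is Pythagorean; hence \<open>T\<^sub>m\<^sub>+\<^sub>1\<close>
  retracts equivariantly onto \<open>T\<^sub>m\<^sup>+\<close>. The two retractions of \<open>(v\<^sub>0, v\<^sub>1, t)\<close> to \<open>T\<^sub>m\<^sup>+\<close> differ by a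
  rotation in a plane orthogonal to \<open>t\<close>, which depends naturally on the tuple, so they agree in homology.
\<close>

section \<open>Bar chains with coefficients in a permutation module\<close>

text \<open>Additive maps out of a free abelian group are determined by the generators. Additivity
  is phrased with differences because \<open>frag_induction\<close> generates chains that
  way.\<close>

lemma frag_map_eqI:
  assumes "Poly_Mapping.keys c \<subseteq> S"
    and f: "\<And>a b. f (a - b) = f a - f b" and g: "\<And>a b. g (a - b) = g a - g b"
    and gen: "\<And>x. x \<in> S \<Longrightarrow> f (frag_of x) = g (frag_of x)"
  shows "f c = (g c :: 'b :: ab_group_add)"
  using assms(1)
proof (induction c rule: frag_induction)
  case zero
  show ?case using f[of 0 0] g[of 0 0] by simp
next
  case (one x) then show ?case by (rule gen)
next
  case (diff a b) then show ?case by (simp add: f g)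
qed

abbreviation frag_map :: "('a \<Rightarrow> 'b) \<Rightarrow> ('a \<Rightarrow>\<^sub>0 int) \<Rightarrow> ('b \<Rightarrow>\<^sub>0 int)" where
  "frag_map f \<equiv> frag_extend (\<lambda>x. frag_of (f x))"

definition prepend :: "'g \<Rightarrow> ('g list \<times> 'x \<Rightarrow>\<^sub>0 int) \<Rightarrow> ('g list \<times> 'x \<Rightarrow>\<^sub>0 int)" where
  "prepend g = frag_map (\<lambda>(gs, x). (g # gs, x))"

definition map_point :: "('x \<Rightarrow> 'y) \<Rightarrow> ('g list \<times> 'x \<Rightarrow>\<^sub>0 int) \<Rightarrow> ('g list \<times> 'y \<Rightarrow>\<^sub>0 int)" where
  "map_point f = frag_map (\<lambda>(gs, x). (gs, f x))"

text \<open>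
  A pair \<open>([g\<^sub>1, \<dots>, g\<^sub>q], x)\<close> stands for the bar symbol \<open>[g\<^sub>1|\<dots>|g\<^sub>q] \<otimes> x\<close>; its last face is
  \<open>[g\<^sub>1|\<dots>|g\<^sub>q\<^sub>-\<^sub>1] \<otimes> g\<^sub>q x\<close>. The alternating sum of all faces of \<open>(g # gs, x)\<close> but the zeroth is
  \<open>- inner_simplex gs g x\<close>.
\<close>

locale action_bar = monoid G for G (structure) +
  fixes act :: "'g \<Rightarrow> 'x \<Rightarrow> 'x" and U :: "'x set"
  assumes act_closed: "\<lbrakk>g \<in> carrier G; x \<in> U\<rbrakk> \<Longrightarrow> act g x \<in> U"
    and act_mult: "\<lbrakk>g \<in> carrier G; h \<in> carrier G; x \<in> U\<rbrakk> \<Longrightarrow> act (g \<otimes> h) x = act g (act h x)"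
begin

primrec inner_simplex :: "'g list \<Rightarrow> 'g \<Rightarrow> 'x \<Rightarrow> ('g list \<times> 'x \<Rightarrow>\<^sub>0 int)" where
  "inner_simplex [] g x = frag_of ([], act g x)"
| "inner_simplex (h # gs) g x = frag_of ((g \<otimes> h) # gs, x) - prepend g (inner_simplex gs h x)"

definition inner :: "'g \<Rightarrow> ('g list \<times> 'x \<Rightarrow>\<^sub>0 int) \<Rightarrow> ('g list \<times> 'x \<Rightarrow>\<^sub>0 int)" where
  "inner g = frag_extend (\<lambda>(gs, x). inner_simplex gs g x)"

definition bd :: "('g list \<times> 'x \<Rightarrow>\<^sub>0 int) \<Rightarrow> ('g list \<times> 'x \<Rightarrow>\<^sub>0 int)" where
  "bd = frag_extend (\<lambda>(gs, x). case gs of [] \<Rightarrow> 0 | g # r \<Rightarrow> frag_of (r, x) - inner_simplex r g x)"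

definition simplices :: "'x set \<Rightarrow> nat \<Rightarrow> ('g list \<times> 'x) set" where
  "simplices X q = {(gs, x). length gs = q \<and> set gs \<subseteq> carrier G \<and> x \<in> X}"

definition chains :: "'x set \<Rightarrow> nat \<Rightarrow> ('g list \<times> 'x \<Rightarrow>\<^sub>0 int) set" where
  "chains X q = {c. Poly_Mapping.keys c \<subseteq> simplices X q}"

lemma linear_simps:
  "prepend g (a - b) = prepend g a - prepend g b"
  "inner g (a - b) = inner g a - inner g b"
  "bd (a - b) = bd a - bd b"
  "prepend g (a + b) = prepend g a + prepend g b"
  "inner g (a + b) = inner g a + inner g b"
  "bd (a + b) = bd a + bd b"
  "bd 0 = 0" "prepend g 0 = 0" "inner g 0 = 0" "bd (- a) = - bd a"
  by (simp_all add: prepend_def inner_def bd_def frag_extend_diff frag_extend_add frag_extend_minus)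

lemma gen_simps:
  "prepend g (frag_of (gs, x)) = frag_of (g # gs, x)"
  "inner g (frag_of (gs, x)) = inner_simplex gs g x"
  "bd (frag_of ([], x)) = 0"
  "bd (frag_of (h # gs, x)) = frag_of (gs, x) - inner_simplex gs h x"
  by (simp_all add: prepend_def inner_def bd_def)

text \<open>Prepending acts as a cone: deleting the first entry gives back \<open>c\<close>, and all
  further faces are collected in \<open>inner g\<close>. Together with \<open>inner_prepend\<close>
  this replaces index computations by recursion.\<close>

lemma bd_prepend: "bd (prepend g c) = c - inner g c"
  by (rule frag_map_eqI[of c UNIV]) (auto simp: linear_simps gen_simps)

lemma inner_prepend: "inner g (prepend h c) = prepend (g \<otimes> h) c - prepend g (inner h c)"
  by (rule frag_map_eqI[of c UNIV]) (auto simp: linear_simps gen_simps)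

lemma chains_diff: "a \<in> chains X q \<Longrightarrow> b \<in> chains X q \<Longrightarrow> a - b \<in> chains X q"
  and chains_add: "a \<in> chains X q \<Longrightarrow> b \<in> chains X q \<Longrightarrow> a + b \<in> chains X q"
  and chains_0: "0 \<in> chains X q"
  using keys_diff[of a b] keys_add[of a b] by (auto simp: chains_def)

lemma chains_mono: "X \<subseteq> Y \<Longrightarrow> c \<in> chains X q \<Longrightarrow> c \<in> chains Y q"
  by (auto simp: chains_def simplices_def)

lemma chains_induct [consumes 1, case_names zero gen diff]:
  assumes "c \<in> chains X q" "P 0"
    and "\<And>gs x. length gs = q \<Longrightarrow> set gs \<subseteq> carrier G \<Longrightarrow> x \<in> X \<Longrightarrow> P (frag_of (gs, x))"
    and "\<And>a b. P a \<Longrightarrow> P b \<Longrightarrow> P (a - b)"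
  shows "P c"
  using assms(1)[unfolded chains_def mem_Collect_eq]
  by (rule frag_induction[where P = P]) (use assms in \<open>auto simp: simplices_def\<close>)

lemma chains_eqI:
  assumes "c \<in> chains X q"
    and f: "\<And>a b. f (a - b) = f a - f b" and g: "\<And>a b. g (a - b) = g a - g b"
    and gen: "\<And>gs x. length gs = q \<Longrightarrow> set gs \<subseteq> carrier G \<Longrightarrow> x \<in> X \<Longrightarrow>
      f (frag_of (gs, x)) = g (frag_of (gs, x))"
  shows "f c = (g c :: 'b :: ab_group_add)"
  using assms(1) unfolding chains_def mem_Collect_eq
  by (rule frag_map_eqI[OF _ f g]) (auto simp: simplices_def gen)

lemma frag_of_chains:
  "frag_of (gs, x) \<in> chains X q \<longleftrightarrow> length gs = q \<and> set gs \<subseteq> carrier G \<and> x \<in> X"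
  by (auto simp: chains_def simplices_def)

lemma prepend_chains:
  assumes "g \<in> carrier G" "c \<in> chains X q"
  shows "prepend g c \<in> chains X (Suc q)"
  using assms(2,1) by (induction c rule: chains_induct)
     (auto simp: linear_simps gen_simps chains_0 chains_diff frag_of_chains)

text \<open>Chains live on invariant subsets of one ambient set \<open>U\<close>, so that a single
  action serves all the sets \<open>T m\<close> and \<open>Tp m\<close>.\<close>

definition stable :: "'x set \<Rightarrow> bool" where
  "stable X \<longleftrightarrow> X \<subseteq> U \<and> (\<forall>g \<in> carrier G. \<forall>x \<in> X. act g x \<in> X)"

lemma stable_U: "stable U"
  by (simp add: stable_def act_closed)

lemma inner_simplex_chains:
  assumes "stable X" "x \<in> X"
  shows "set gs \<subseteq> carrier G \<Longrightarrow> g \<in> carrier G \<Longrightarrow> inner_simplex gs g x \<in> chains X (length gs)"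
proof (induction gs arbitrary: g)
  case Nil then show ?case using assms by (auto simp: frag_of_chains stable_def)
next
  case (Cons h gs)
  then show ?case using assms by (auto intro!: chains_diff prepend_chains simp: frag_of_chains)
qed

lemma bd_chains:
  assumes "stable X" "c \<in> chains X (Suc q)"
  shows "bd c \<in> chains X q"
  using assms(2)
proof (induction c rule: chains_induct)
  case (gen gs x)
  then obtain g r where "gs = g # r" by (cases gs) auto
  then show ?case using gen inner_simplex_chains[OF assms(1)]
    by (auto simp: gen_simps frag_of_chains intro!: chains_diff)
qed (auto simp: linear_simps chains_0 chains_diff)

lemma bd_chains_0: "c \<in> chains X 0 \<Longrightarrow> bd c = 0"
  by (induction c rule: chains_induct) (auto simp: linear_simps gen_simps)

lemma inner_inner_simplex:
  assumes "x \<in> U" "set gs \<subseteq> carrier G" "g \<in> carrier G" "h \<in> carrier G"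
  shows "inner g (inner_simplex gs h x) = inner_simplex gs (g \<otimes> h) x"
  using assms(2-)
proof (induction gs arbitrary: g h)
  case Nil then show ?case by (simp add: gen_simps act_mult assms(1))
next
  case (Cons k gs)
  then show ?case by (simp add: gen_simps linear_simps inner_prepend m_assoc)
qed

text \<open>This is the content of \<open>bd_bd\<close>, since the boundary of
  \<open>(g # gs, x)\<close> is \<open>(gs, x)\<close> minus its inner simplex.\<close>

lemma bd_inner_simplex:
  assumes "x \<in> U" "set gs \<subseteq> carrier G" "g \<in> carrier G"
  shows "bd (inner_simplex gs g x) = bd (frag_of (gs, x))"
  using assms(2-)
proof (cases gs)
  case Nil then show ?thesis by (simp add: gen_simps)
next
  case (Cons h r)
  then show ?thesis using assms by (simp add: gen_simps linear_simps bd_prepend inner_inner_simplex)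
qed

lemma bd_bd:
  assumes "c \<in> chains U q" shows "bd (bd c) = 0"
  using assms
proof (induction c rule: chains_induct)
  case (gen gs x)
  then show ?case by (cases gs) (auto simp: gen_simps linear_simps bd_inner_simplex)
qed (auto simp: linear_simps)

end

section \<open>Chain maps induced by morphisms of actions\<close>

lemma map_point_linear:
  "map_point f (a - b) = map_point f a - map_point f b"
  "map_point f (a + b) = map_point f a + map_point f b"
  "map_point f 0 = 0"
  "map_point f (- a) = - map_point f a"
  "map_point f (frag_of (gs, x)) = frag_of (gs, f x)"
  by (simp_all add: map_point_def frag_extend_diff frag_extend_add frag_extend_minus)

locale action_bar_map = A: action_bar G act U + B: action_bar H act' U'
  for G (structure) and act :: "'g \<Rightarrow> 'x \<Rightarrow> 'x" and U
    and H :: "('h, 'n) monoid_scheme" (structure) and act' :: "'h \<Rightarrow> 'y \<Rightarrow> 'y" and U' +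
  fixes phi :: "'g \<Rightarrow> 'h" and f :: "'x \<Rightarrow> 'y" and X :: "'x set"
  assumes X: "A.stable X"
    and phi_closed: "g \<in> carrier G \<Longrightarrow> phi g \<in> carrier H"
    and phi_mult: "\<lbrakk>g \<in> carrier G; h \<in> carrier G\<rbrakk> \<Longrightarrow> phi (g \<otimes>\<^bsub>G\<^esub> h) = phi g \<otimes>\<^bsub>H\<^esub> phi h"
    and f_closed: "x \<in> X \<Longrightarrow> f x \<in> U'"
    and f_act: "\<lbrakk>g \<in> carrier G; x \<in> X\<rbrakk> \<Longrightarrow> f (act g x) = act' (phi g) (f x)"
begin

definition push :: "('g list \<times> 'x \<Rightarrow>\<^sub>0 int) \<Rightarrow> ('h list \<times> 'y \<Rightarrow>\<^sub>0 int)" where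
  "push = frag_map (\<lambda>(gs, x). (map phi gs, f x))"

lemma push_simps:
  "push (a - b) = push a - push b" "push 0 = 0"
  "push (frag_of (gs, x)) = frag_of (map phi gs, f x)"
  by (simp_all add: push_def frag_extend_diff)

lemma push_prepend: "push (prepend g c) = prepend (phi g) (push c)"
  by (rule frag_map_eqI[of c UNIV]) (auto simp: push_simps A.linear_simps A.gen_simps B.linear_simps B.gen_simps)

lemma push_inner_simplex:
  assumes "x \<in> X" "set gs \<subseteq> carrier G" "g \<in> carrier G"
  shows "push (A.inner_simplex gs g x) = B.inner_simplex (map phi gs) (phi g) (f x)"
  using assms(2,3)
  by (induction gs arbitrary: g) (auto simp: push_simps push_prepend phi_mult f_act assms(1))

lemma push_bd:
  assumes "c \<in> A.chains X q"
  shows "push (A.bd c) = B.bd (push c)"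
proof (rule A.chains_eqI[OF assms(1)])
  fix gs x assume "length gs = q" "set gs \<subseteq> carrier G" "x \<in> X"
  then show "push (A.bd (frag_of (gs, x))) = B.bd (push (frag_of (gs, x)))"
    by (cases gs) (auto simp: push_simps A.gen_simps B.gen_simps push_inner_simplex)
qed (auto simp: push_simps A.linear_simps B.linear_simps)

end

section \<open>Chain homotopies from natural transformations\<close>

text \<open>
  The pairs \<open>(phi0, f0)\<close> and \<open>(phi1, f1)\<close> are functors of action groupoids, and \<open>s\<close> is a natural
  transformation between them.
\<close>

locale action_bar_homotopy =
  A: action_bar G act U + B: action_bar H act' U' +
  F0: action_bar_map G act U H act' U' phi0 f0 X + F1: action_bar_map G act U H act' U' phi1 f1 X
  for G (structure) and act :: "'g \<Rightarrow> 'x \<Rightarrow> 'x" and U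
    and H :: "('h, 'n) monoid_scheme" (structure) and act' :: "'h \<Rightarrow> 'y \<Rightarrow> 'y" and U'
    and phi0 f0 phi1 f1 X +
  fixes s :: "'x \<Rightarrow> 'h"
  assumes s_closed: "x \<in> X \<Longrightarrow> s x \<in> carrier H"
    and s_f: "x \<in> X \<Longrightarrow> f0 x = act' (s x) (f1 x)"
    and s_act: "\<lbrakk>g \<in> carrier G; x \<in> X\<rbrakk> \<Longrightarrow> s (act g x) \<otimes>\<^bsub>H\<^esub> phi1 g = phi0 g \<otimes>\<^bsub>H\<^esub> s x"
begin

text \<open>The usual triangulated prism: the sum over \<open>j\<close> of \<open>(-1)^j\<close>
  times \<open>[phi0 g_1|...|phi0 g_j|s|phi1 g_(j+1)|...|phi1 g_q]\<close> at \<open>f1 x\<close>,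
  with \<open>s\<close> taken at the object that \<open>g_q, ..., g_(j+1)\<close> reach from
  \<open>x\<close>.\<close>

primrec prism_simplex :: "'g list \<Rightarrow> 'x \<Rightarrow> ('h list \<times> 'y \<Rightarrow>\<^sub>0 int)" where
  "prism_simplex [] x = frag_of ([s x], f1 x)"
| "prism_simplex (g # r) x =
     frag_of (s (foldr act (g # r) x) # map phi1 (g # r), f1 x) - prepend (phi0 g) (prism_simplex r x)"

definition prism :: "('g list \<times> 'x \<Rightarrow>\<^sub>0 int) \<Rightarrow> ('h list \<times> 'y \<Rightarrow>\<^sub>0 int)" where
  "prism = frag_extend (\<lambda>(gs, x). prism_simplex gs x)"

lemma prism_simps:
  "prism (a - b) = prism a - prism b" "prism 0 = 0"
  "prism (frag_of (gs, x)) = prism_simplex gs x"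
  by (simp_all add: prism_def frag_extend_diff)

lemma foldr_act: "x \<in> X \<Longrightarrow> set gs \<subseteq> carrier G \<Longrightarrow> foldr act gs x \<in> X"
proof (induction gs)
  case (Cons g gs)
  then show ?case using F0.X by (simp add: A.stable_def)
qed simp

lemma prism_chains:
  assumes "c \<in> A.chains X q" "f1 ` X \<subseteq> Y"
  shows "prism c \<in> B.chains Y (Suc q)"
  using assms(1)
proof (induction c rule: A.chains_induct)
  case (gen gs x)
  have "prism_simplex gs x \<in> B.chains Y (Suc (length gs))"
    using gen(2)
  proof (induction gs)
    case (Cons g gs)
    have "set gs \<subseteq> carrier G" "g \<in> carrier G" using Cons.prems by auto
    moreover have "s (foldr act (g # gs) x) \<in> carrier H"
      using s_closed foldr_act[OF gen(3) Cons.prems(1)] by blast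
    moreover have "prism_simplex gs x \<in> B.chains Y (Suc (length gs))"
      using Cons by auto
    moreover have "f1 x \<in> Y" "set (map phi1 (g # gs)) \<subseteq> carrier H"
      using gen(3) assms(2) Cons.prems F1.phi_closed by auto
    ultimately show ?case
      using F0.phi_closed by (auto intro!: B.chains_diff B.prepend_chains simp: B.frag_of_chains)
  qed (use gen(3) assms(2) in \<open>auto simp: B.frag_of_chains s_closed\<close>)
  then show ?case using gen by (simp add: prism_simps)
qed (auto simp: prism_simps B.chains_0 B.chains_diff)

text \<open>All simplices occurring in \<open>inner_simplex r h x\<close> have the same initial object as \<open>(h # r, x)\<close>.\<close>

lemma prism_prepend_inner:
  assumes "x \<in> X" "set r \<subseteq> carrier G" "h \<in> carrier G" "g \<in> carrier G"
  shows "prism (prepend g (A.inner_simplex r h x)) =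
    prepend (s (foldr act (g # h # r) x)) (prepend (phi1 g) (F1.push (A.inner_simplex r h x)))
      - prepend (phi0 g) (prism (A.inner_simplex r h x))"
proof -
  have "foldr act gs y = foldr act (h # r) x"
    if "(gs, y) \<in> Poly_Mapping.keys (A.inner_simplex r h x)" for gs y
    using that assms(2,3)
  proof (induction r arbitrary: h gs)
    case (Cons k r)
    have *: "foldr act r x \<in> U" using foldr_act[OF assms(1)] Cons.prems F0.X by (auto simp: A.stable_def)
    have "(gs, y) = ((h \<otimes>\<^bsub>G\<^esub> k) # r, x) \<or>
       (gs, y) \<in> Poly_Mapping.keys (prepend h (A.inner_simplex r k x))"
      using Cons.prems(1) keys_diff by fastforce
    moreover have "\<exists>gs'. gs = h # gs' \<and> (gs', y) \<in> Poly_Mapping.keys (A.inner_simplex r k x)"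
      if "(gs, y) \<in> Poly_Mapping.keys (prepend h (A.inner_simplex r k x))"
      using that keys_frag_extend[of "\<lambda>x. frag_of (case x of (gs, x) \<Rightarrow> (h # gs, x))"
        "A.inner_simplex r k x"] by (fastforce simp: prepend_def)
    ultimately show ?case using Cons * by (auto simp: A.act_mult)
  qed auto
  then have *: "Poly_Mapping.keys (A.inner_simplex r h x) \<subseteq> {(gs, y). foldr act gs y = foldr act (h # r) x}"
    by auto
  show ?thesis
    by (rule frag_map_eqI[OF *])
      (auto simp: prism_simps A.linear_simps B.linear_simps A.gen_simps B.gen_simps F1.push_simps)
qed

text \<open>What \<open>bd_prism\<close> says for \<open>(g # r, x)\<close> after the terms that
  arise by deleting a first entry have been cancelled.\<close>

lemma inner_prism:
  assumes x: "x \<in> X" and "set r \<subseteq> carrier G" "g \<in> carrier G"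
  shows "B.inner (phi0 g) (prism_simplex r x) - prism (A.inner_simplex r g x) =
    B.inner (s (foldr act (g # r) x)) (frag_of (map phi1 (g # r), f1 x)) - frag_of (map phi0 (g # r), f0 x)"
  using assms(2,3)
proof (induction r arbitrary: g)
  case Nil
  then show ?case using x F0.X
    by (simp add: B.gen_simps prism_simps F1.f_act s_act s_f)
next
  case (Cons h r)
  have st: "\<And>g x. g \<in> carrier G \<Longrightarrow> x \<in> X \<Longrightarrow> act g x \<in> X" and sU: "\<And>x. x \<in> X \<Longrightarrow> x \<in> U"
    using F0.X by (auto simp: A.stable_def)
  define x1 where "x1 = foldr act (h # r) x"
  have rX: "foldr act r x \<in> X" using foldr_act[OF x] Cons.prems by auto
  have x1: "x1 \<in> X" using foldr_act[OF x, of "h # r"] Cons.prems by (auto simp: x1_def)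
  have g: "g \<in> carrier G" and h: "h \<in> carrier G" and r: "set r \<subseteq> carrier G" using Cons.prems by auto
  have x0: "foldr act ((g \<otimes>\<^bsub>G\<^esub> h) # r) x = act g x1" using g h rX sU by (simp add: x1_def A.act_mult)
  define c where "c = A.inner_simplex r h x"
  define b where "b = frag_of (map phi1 (h # r), f1 x)"
  have IH: "prism c = B.inner (phi0 h) (prism_simplex r x) - B.inner (s x1) b
      + frag_of (map phi0 (h # r), f0 x)"
    using Cons.IH[OF r h] unfolding c_def[symmetric] b_def[symmetric] x1_def by (simp add: algebra_simps)
  have P: "prism_simplex (h # r) x = prepend (s x1) b - prepend (phi0 h) (prism_simplex r x)"
    by (simp add: x1_def b_def B.gen_simps)
  have F: "B.inner_simplex (map phi1 (h # r)) (phi1 g) (f1 x) = 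
      frag_of (map phi1 ((g \<otimes>\<^bsub>G\<^esub> h) # r), f1 x) - prepend (phi1 g) (F1.push c)"
    using F1.push_inner_simplex[OF x, of "h # r" g] g h r by (simp add: c_def F1.push_simps F1.push_prepend)
  have s: "s (act g x1) \<otimes>\<^bsub>H\<^esub> phi1 g = phi0 g \<otimes>\<^bsub>H\<^esub> s x1" using s_act g x1 by simp
  have x0': "foldr act (g # h # r) x = act g x1" by (simp add: x1_def)
  have 1: "prism (A.inner_simplex (h # r) g x) =
     (prepend (s (act g x1)) (frag_of (map phi1 ((g \<otimes>\<^bsub>G\<^esub> h) # r), f1 x))
       - prepend (phi0 (g \<otimes>\<^bsub>G\<^esub> h)) (prism_simplex r x))
     - (prepend (s (act g x1)) (prepend (phi1 g) (F1.push c)) - prepend (phi0 g) (prism c))"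
    using prism_prepend_inner[OF x r h g] x0 x0'
    by (simp add: prism_simps c_def B.gen_simps)
  \<comment> \<open>Naturality of \<open>s\<close> enters here: composing \<open>s\<close> with
    \<open>phi1 g\<close> is the same as composing \<open>phi0 g\<close> with
    \<open>s\<close>.\<close>
  have 2: "B.inner (s (act g x1)) (frag_of (map phi1 (g # h # r), f1 x)) =
     prepend (phi0 g \<otimes>\<^bsub>H\<^esub> s x1) b - prepend (s (act g x1)) (B.inner (phi1 g) b)"
    using B.inner_prepend[of "s (act g x1)" "phi1 g" b] s by (simp add: b_def B.gen_simps)
  have 3: "B.inner (phi1 g) b = B.inner_simplex (map phi1 (h # r)) (phi1 g) (f1 x)"
    by (simp add: b_def B.gen_simps)
  have 4: "frag_of (map phi0 (g # h # r), f0 x) = prepend (phi0 g) (frag_of (map phi0 (h # r), f0 x))"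
    by (simp add: B.gen_simps)
  show ?case
    unfolding x0' 1 2 3 4 F P IH F0.phi_mult[OF g h] B.linear_simps B.inner_prepend
    by (simp only: algebra_simps)
qed

lemma bd_prism:
  assumes "c \<in> A.chains X q"
  shows "B.bd (prism c) + prism (A.bd c) = F1.push c - F0.push c"
proof (rule A.chains_eqI[OF assms(1)])
  fix gs x assume *: "length gs = q" "set gs \<subseteq> carrier G" "x \<in> X"
  show "B.bd (prism (frag_of (gs, x))) + prism (A.bd (frag_of (gs, x))) =
    F1.push (frag_of (gs, x)) - F0.push (frag_of (gs, x))"
  proof (cases gs)
    case Nil
    then show ?thesis using * by (simp add: prism_simps A.gen_simps B.gen_simps F0.push_simps F1.push_simps s_f)
  next
    case (Cons g r)
    have "prism_simplex gs x = prepend (s (foldr act (g # r) x)) (frag_of (map phi1 (g # r), f1 x))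
        - prepend (phi0 g) (prism_simplex r x)"
      by (simp add: Cons B.gen_simps)
    then show ?thesis using * inner_prism[of x r g] Cons
      by (simp add: prism_simps A.gen_simps B.linear_simps B.bd_prepend F0.push_simps F1.push_simps algebra_simps)
  qed
qed (auto simp: prism_simps A.linear_simps B.linear_simps F0.push_simps F1.push_simps algebra_simps)

end

section \<open>Stability for configurations\<close>

lemma frag_cmul_diff_right: "frag_cmul i (a - b) = frag_cmul i a - frag_cmul i b"
  by (rule poly_mapping_eqI) (simp add: lookup_minus algebra_simps)

definition omit :: "nat \<Rightarrow> 'v list \<Rightarrow> 'v list" where
  "omit j t = take j t @ drop (Suc j) t"

lemma omit_simps [simp]: "omit 0 t = tl t" "omit (Suc j) (v # t) = v # omit j t"
  by (simp_all add: omit_def drop_Suc)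

lemma omit_map: "omit j (map f t) = map f (omit j t)"
  by (simp add: omit_def take_map drop_map)

lemma map_point_map_point: "map_point f (map_point g c) = map_point (f \<circ> g) c"
  by (rule frag_map_eqI[of c UNIV]) (auto simp: map_point_linear)

lemma map_point_cong:
  assumes "\<And>gs x. (gs, x) \<in> Poly_Mapping.keys c \<Longrightarrow> f x = g x"
  shows "map_point f c = map_point g c"
  by (rule frag_map_eqI[of c "Poly_Mapping.keys c"]) (use assms in \<open>auto simp: map_point_linear\<close>)

lemma map_point_ident: "map_point (\<lambda>x. x) c = c"
  by (rule frag_map_eqI[of c UNIV]) (auto simp: map_point_linear)

context action_bar
begin

lemma map_point_chains:
  assumes "c \<in> chains X q" "\<And>x. x \<in> X \<Longrightarrow> f x \<in> Y"
  shows "map_point f c \<in> chains Y q"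
  using assms(1) by (induction c rule: chains_induct)
    (use assms(2) in \<open>auto simp: map_point_linear chains_0 chains_diff frag_of_chains\<close>)

lemma map_point_bd:
  assumes "stable X" "\<And>x. x \<in> X \<Longrightarrow> f x \<in> U"
    and "\<And>g x. g \<in> carrier G \<Longrightarrow> x \<in> X \<Longrightarrow> f (act g x) = act g (f x)"
    and "c \<in> chains X q"
  shows "map_point f (bd c) = bd (map_point f c)"
proof -
  interpret F: action_bar_map G act U G act U "\<lambda>g. g" f X
    using assms by unfold_locales auto
  have "F.push = map_point f" by (simp add: F.push_def map_point_def)
  then show ?thesis using F.push_bd[OF assms(4)] by simp
qed

end

text \<open>
  \<open>T m\<close> and \<open>Tp m\<close> abstract the sets \<open>T\<^sub>m\<close> and \<open>T\<^sub>m\<^sup>+\<close> of the introduction, \<open>rho\<close> is the retraction of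
  \<open>T\<^sub>m\<^sub>+\<^sub>1\<close> onto \<open>T\<^sub>m\<^sup>+\<close>, and \<open>turn\<close> chooses the rotations that relate its two composites with the faces.
\<close>

locale configurations = action_bar G "\<lambda>g. map (a g)" "{t. set t \<subseteq> V}"
  for G :: "('g, 'm) monoid_scheme" (structure) and a :: "'g \<Rightarrow> 'v \<Rightarrow> 'v" and V +
  fixes T Tp :: "nat \<Rightarrow> 'v list set" and rho :: "'v list \<Rightarrow> 'v list"
    and turn :: "'v list \<Rightarrow> 'g" and N :: nat
  assumes T_lists: "t \<in> T m \<Longrightarrow> length t = m \<and> set t \<subseteq> V"
    and T_act: "\<lbrakk>g \<in> carrier G; t \<in> T m\<rbrakk> \<Longrightarrow> map (a g) t \<in> T m"
    and T_omit: "\<lbrakk>t \<in> T (Suc m); j \<le> m\<rbrakk> \<Longrightarrow> omit j t \<in> T m"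
    and T_extend: "\<lbrakk>finite S; S \<subseteq> T m; m < N\<rbrakk> \<Longrightarrow> \<exists>v. \<forall>t \<in> S. v # t \<in> T (Suc m)"
    and Tp_T: "t \<in> Tp m \<Longrightarrow> t \<in> T (Suc m)"
    and Tp_act: "\<lbrakk>g \<in> carrier G; t \<in> Tp m\<rbrakk> \<Longrightarrow> map (a g) t \<in> Tp m"
    and Tp_omit: "\<lbrakk>t \<in> Tp (Suc m); j \<le> m\<rbrakk> \<Longrightarrow> omit (Suc j) t \<in> Tp m"
    and rho_closed: "t \<in> T (Suc m) \<Longrightarrow> rho t \<in> Tp m"
    and rho_act: "\<lbrakk>g \<in> carrier G; t \<in> T (Suc m)\<rbrakk> \<Longrightarrow> rho (map (a g) t) = map (a g) (rho t)"
    and tl_rho: "t \<in> T (Suc m) \<Longrightarrow> tl (rho t) = tl t"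
    and rho_id: "t \<in> Tp m \<Longrightarrow> rho t = t"
    and turn_closed: "t \<in> T (Suc (Suc m)) \<Longrightarrow> turn t \<in> carrier G"
    and turn_act: "\<lbrakk>g \<in> carrier G; t \<in> T (Suc (Suc m))\<rbrakk> \<Longrightarrow> turn (map (a g) t) \<otimes> g = g \<otimes> turn t"
    and turn_rho: "t \<in> T (Suc (Suc m)) \<Longrightarrow> rho (omit 0 t) = map (a (turn t)) (rho (omit (Suc 0) t))"
begin

lemma stable_T: "stable (T m)" and stable_Tp: "stable (Tp m)"
  using T_lists T_act Tp_T Tp_act unfolding stable_def by blast+

lemma chains_Tp_T: "c \<in> chains (Tp m) q \<Longrightarrow> c \<in> chains (T (Suc m)) q"
  by (rule chains_mono) (auto simp: Tp_T)

lemma bd_bd_T: "c \<in> chains (T m) q \<Longrightarrow> bd (bd c) = 0"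
  by (rule bd_bd, rule chains_mono) (use T_lists in auto)

text \<open>
  Only the first \<open>k\<close> entries of a tuple take part in the differential \<open>D k\<close>; the remaining ones are
  a parameter. \<open>D' k\<close> is \<open>D k\<close> applied behind the first entry.
\<close>

definition D :: "nat \<Rightarrow> ('g list \<times> 'v list \<Rightarrow>\<^sub>0 int) \<Rightarrow> ('g list \<times> 'v list \<Rightarrow>\<^sub>0 int)" where
  "D k c = (\<Sum>j<k. frag_cmul ((-1) ^ j) (map_point (omit j) c))"

definition D' :: "nat \<Rightarrow> ('g list \<times> 'v list \<Rightarrow>\<^sub>0 int) \<Rightarrow> ('g list \<times> 'v list \<Rightarrow>\<^sub>0 int)" where
  "D' k c = (\<Sum>j<k. frag_cmul ((-1) ^ j) (map_point (omit (Suc j)) c))"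

section \<open>The differentials of the configuration complex\<close>

lemma chains_cmul: "c \<in> chains X q \<Longrightarrow> frag_cmul i c \<in> chains X q"
  using keys_cmul[of i c] by (auto simp: chains_def)

lemma chains_sum: "(\<And>j. j \<in> J \<Longrightarrow> f j \<in> chains X q) \<Longrightarrow> sum f J \<in> chains X q"
  by (induction J rule: infinite_finite_induct) (auto simp: chains_0 chains_add)

lemma bd_cmul_sum: "bd (\<Sum>j\<in>J. frag_cmul (i j) (f j)) = (\<Sum>j\<in>J. frag_cmul (i j) (bd (f j)))"
  by (induction J rule: infinite_finite_induct,
      simp_all add: linear_simps, simp_all add: bd_def frag_extend_cmul)

lemma map_point_cmul_sum: "map_point h (\<Sum>j\<in>J. frag_cmul (i j) (f j)) = (\<Sum>j\<in>J. frag_cmul (i j) (map_point h (f j)))"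
  by (induction J rule: infinite_finite_induct,
      simp_all add: map_point_linear, simp_all add: map_point_def frag_extend_cmul)

lemma D_linear: "D k (x - y) = D k x - D k y" "D k (x + y) = D k x + D k y" "D k 0 = 0"
  by (simp_all add: D_def map_point_linear frag_cmul_diff_right frag_cmul_distrib2 sum_subtractf sum.distrib)

lemma D_0: "D 0 c = 0"
  by (simp add: D_def)

lemma D_Suc: "D (Suc k) c = map_point tl c - D' k c"
proof -
  have [simp]: "omit 0 = (tl :: 'v list \<Rightarrow> 'v list)" by (rule ext) simp
  show ?thesis
    unfolding D_def D'_def sum.lessThan_Suc_shift by (simp flip: sum_negf)
qed

text \<open>The cone formula: prepending a vector is a contracting homotopy. Both \<open>D_D\<close>
  and \<open>exact\<close> rest on it.\<close>

lemma D_cons: "D (Suc k) (map_point (Cons v) c) = c - map_point (Cons v) (D k c)"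
proof -
  have 1: "tl \<circ> (#) v = (\<lambda>t. t)" and 2: "\<And>j. omit (Suc j) \<circ> (#) v = (#) v \<circ> omit j"
    by auto
  have "D' k (map_point (Cons v) c) = map_point (Cons v) (D k c)"
    by (simp add: D'_def D_def map_point_cmul_sum map_point_map_point 2)
  then show ?thesis by (simp add: D_Suc map_point_map_point 1 map_point_ident)
qed

lemma omit_chains: "\<lbrakk>c \<in> chains (T (Suc m)) q; j \<le> m\<rbrakk> \<Longrightarrow> map_point (omit j) c \<in> chains (T m) q"
  by (rule map_point_chains[where X = "T (Suc m)"]) (auto intro: T_omit)

lemma omit_bd:
  assumes "c \<in> chains (T (Suc m)) q" "j \<le> m"
  shows "map_point (omit j) (bd c) = bd (map_point (omit j) c)"
proof (rule map_point_bd[OF stable_T _ _ assms(1)])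
  fix t assume "t \<in> T (Suc m)"
  then show "omit j t \<in> {t. set t \<subseteq> V}" using T_omit[OF _ assms(2)] T_lists by blast
qed (auto simp: omit_map)

lemma D_chains:
  assumes "c \<in> chains (T m) q" "k \<le> m"
  shows "D k c \<in> chains (T (m - 1)) q"
proof (cases m)
  case 0 then show ?thesis using assms by (simp add: D_0 chains_0)
next
  case (Suc m') then show ?thesis using assms
    by (auto simp: D_def intro!: chains_sum chains_cmul omit_chains)
qed

lemma D_bd:
  assumes "c \<in> chains (T m) q" "k \<le> m"
  shows "D k (bd c) = bd (D k c)"
proof (cases m)
  case 0 then show ?thesis using assms by (simp add: D_0 linear_simps)
next
  case (Suc m')
  then have "map_point (omit j) (bd c) = bd (map_point (omit j) c)" if "j < k" for j
    using that assms omit_bd[of c m' q j] by simp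
  then show ?thesis by (simp add: D_def bd_cmul_sum)
qed

lemma D_D:
  assumes "c \<in> chains (T m) q" "Suc k \<le> m"
  shows "D k (D (Suc k) c) = 0"
proof -
  have *: "D k (D (Suc k) (frag_of (gs, t))) = 0" if "Suc k \<le> length t"
    for gs :: "'g list" and t :: "'v list"
    using that
  proof (induction k arbitrary: t)
    case (Suc k)
    then obtain v u where t: "t = v # u" by (cases t) auto
    have c: "frag_of (gs, t) = map_point (Cons v) (frag_of (gs, u))" by (simp add: t map_point_linear)
    have "D k (D (Suc k) (frag_of (gs, u))) = 0" using Suc t by simp
    then show ?case unfolding c D_cons by (simp add: D_linear D_cons map_point_linear)
  qed (simp add: D_0)
  show ?thesis
    by (rule chains_eqI[OF assms(1), of "\<lambda>c. D k (D (Suc k) c)" "\<lambda>c. 0"])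
       (use * assms T_lists in \<open>auto simp: D_linear\<close>)
qed

lemma D'_bd:
  assumes "c \<in> chains (T (Suc m)) q" "k \<le> m"
  shows "D' k (bd c) = bd (D' k c)"
proof -
  have "map_point (omit (Suc j)) (bd c) = bd (map_point (omit (Suc j)) c)" if "j < k" for j
    using that assms omit_bd[of c m q "Suc j"] by simp
  then show ?thesis by (simp add: D'_def bd_cmul_sum)
qed

lemma D'_chains:
  assumes "c \<in> chains (Tp (Suc m)) q" "k \<le> Suc m"
  shows "D' k c \<in> chains (Tp m) q"
  using assms by (auto simp: D'_def intro!: chains_sum chains_cmul map_point_chains[where X = "Tp (Suc m)"] Tp_omit)

lemma tl_D':
  assumes "c \<in> chains (T (Suc m)) q" 
  shows "map_point tl (D' k c) = D k (map_point tl c)"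
proof -
  have "map_point (tl \<circ> omit (Suc j)) c = map_point (omit j \<circ> tl) c" for j
  proof (rule map_point_cong)
    fix gs t assume "(gs, t) \<in> Poly_Mapping.keys c"
    then have "t \<in> T (Suc m)" using assms by (auto simp: chains_def simplices_def)
    then obtain v u where "t = v # u" using T_lists[of t] by (cases t) auto
    then show "(tl \<circ> omit (Suc j)) t = (omit j \<circ> tl) t" by simp
  qed
  then show ?thesis by (simp add: D_def D'_def map_point_cmul_sum map_point_map_point)
qed

text \<open>Only finitely many tuples occur in \<open>c\<close>, so one generic vector can be put in
  front of all of them, and \<open>D_cons\<close> applies. The vector is not chosen equivariantly,
  so the filling need not be a cycle when \<open>c\<close> is one; \<open>cycle_lift\<close> repairs
  this.\<close>

lemma exact:
  assumes c: "c \<in> chains (T m) q" and "D k c = 0" "m < N"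
  shows "\<exists>e \<in> chains (T (Suc m)) q. D (Suc k) e = c"
proof -
  have "snd ` Poly_Mapping.keys c \<subseteq> T m" using c by (auto simp: chains_def simplices_def)
  then obtain v where v: "\<forall>t \<in> snd ` Poly_Mapping.keys c. v # t \<in> T (Suc m)"
    using T_extend[of "snd ` Poly_Mapping.keys c" m] assms by auto
  have "c \<in> chains (snd ` Poly_Mapping.keys c) q" using c by (force simp: chains_def simplices_def)
  then have "map_point (Cons v) c \<in> chains (T (Suc m)) q"
    by (rule map_point_chains) (use v in auto)
  moreover have "D (Suc k) (map_point (Cons v) c) = c" using assms by (simp add: D_cons map_point_linear)
  ultimately show ?thesis by blast
qed

section \<open>The induction on the homological degree\<close>

definition surj_at :: "nat \<Rightarrow> nat \<Rightarrow> bool" where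
  "surj_at q m \<longleftrightarrow> (\<forall>z \<in> chains (T m) q. bd z = 0 \<longrightarrow>
     (\<exists>y \<in> chains (Tp m) q. bd y = 0 \<and> map_point tl y = z))"

definition inj_at :: "nat \<Rightarrow> nat \<Rightarrow> bool" where
  "inj_at q m \<longleftrightarrow> (\<forall>y \<in> chains (Tp m) q. \<forall>b \<in> chains (T m) (Suc q). bd y = 0 \<longrightarrow>
     map_point tl y = bd b \<longrightarrow> (\<exists>f \<in> chains (Tp m) (Suc q). bd f = y))"

text \<open>
  Injectivity of the map from the \<open>q\<close>-th homology of the kernel of \<open>D k\<close> to \<open>H\<^sub>q(G; \<int>[T\<^sub>m])\<close>.
\<close>

definition lift_at :: "nat \<Rightarrow> nat \<Rightarrow> nat \<Rightarrow> bool" where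
  "lift_at q m k \<longleftrightarrow> (\<forall>b \<in> chains (T m) (Suc q). D k (bd b) = 0 \<longrightarrow>
     (\<exists>b' \<in> chains (T m) (Suc q). D k b' = 0 \<and> bd b' = bd b))"

lemma row_exact:
  assumes S: "surj_at q (Suc m)" and I: "inj_at q m" and k: "k \<le> Suc m"
    and x: "x \<in> chains (T (Suc m)) q" "bd x = 0" and b: "b \<in> chains (T m) (Suc q)" "D k x = bd b"
  shows "\<exists>y \<in> chains (T (Suc (Suc m))) q. \<exists>f \<in> chains (T (Suc m)) (Suc q).
    bd y = 0 \<and> x = D (Suc k) y + bd f"
proof -
  obtain y where y: "y \<in> chains (Tp (Suc m)) q" "bd y = 0" "map_point tl y = x"
    using S x unfolding surj_at_def by blast
  have y': "y \<in> chains (T (Suc (Suc m))) q" using y(1) by (rule chains_Tp_T)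
  have "bd (D' k y) = 0" using D'_bd[OF y' k] y(2) by (simp add: D'_def map_point_linear)
  moreover have "map_point tl (D' k y) = bd b" using tl_D'[OF y'] y(3) b(2) by simp
  moreover have "D' k y \<in> chains (Tp m) q" using D'_chains[OF y(1) k] .
  ultimately obtain f where f: "f \<in> chains (Tp m) (Suc q)" "bd f = D' k y"
    using I b(1) unfolding inj_at_def by blast
  have "x = D (Suc k) y + bd f" using y f by (simp add: D_Suc)
  then show ?thesis using y' y(2) chains_Tp_T[OF f(1)] by blast
qed

text \<open>The boundary of \<open>e\<close> is killed by \<open>D k\<close>, hence is also the
  boundary of some \<open>e'\<close> with \<open>D k e' = 0\<close>; then \<open>e - e'\<close> is a
  cycle with the same image. In degree \<open>0\<close> every chain is a cycle.\<close>

lemma cycle_lift: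
  assumes "q = 0 \<or> lift_at (q - 1) m k" "e \<in> chains (T m) q" "k \<le> m" "bd (D k e) = 0"
  shows "\<exists>x \<in> chains (T m) q. bd x = 0 \<and> D k x = D k e"
proof (cases q)
  case 0
  then show ?thesis using assms bd_chains_0 by auto
next
  case (Suc p)
  then obtain e' where e': "e' \<in> chains (T m) q" "D k e' = 0" "bd e' = bd e"
    using assms D_bd[OF assms(2,3)] unfolding lift_at_def by auto
  then have "e - e' \<in> chains (T m) q" "bd (e - e') = 0" "D k (e - e') = D k e"
    using assms by (auto simp: chains_diff linear_simps D_linear)
  then show ?thesis by blast
qed

text \<open>\<open>D 1\<close> forgets the first vector and \<open>rho\<close> keeps all others. So
  applying \<open>rho\<close> to a cycle \<open>x\<close> with \<open>D 1 x = z\<close> lifts the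
  cycle \<open>z\<close> itself, not just its class.\<close>

lemma surj_step:
  assumes L: "q = 0 \<or> lift_at (q - 1) (Suc m) 1" and "m < N"
  shows "surj_at q m"
  unfolding surj_at_def
proof (intro ballI impI)
  fix z assume z: "z \<in> chains (T m) q" "bd z = 0"
  obtain e where e: "e \<in> chains (T (Suc m)) q" "D 1 e = z"
    using exact[OF z(1), of 0] assms(2) by (auto simp: D_0)
  then obtain x where x: "x \<in> chains (T (Suc m)) q" "bd x = 0" "D 1 x = z"
    using cycle_lift[OF L e(1)] z by auto
  have rx: "map_point rho x \<in> chains (Tp m) q"
    using x(1) by (rule map_point_chains) (rule rho_closed)
  have rb: "bd (map_point rho x) = 0"
    using map_point_bd[OF stable_T _ _ x(1), of rho] rho_closed rho_act T_lists Tp_T x(2)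
    by (fastforce simp: map_point_linear)
  have "map_point tl (map_point rho x) = map_point tl x"
    unfolding map_point_map_point by (rule map_point_cong) (use x(1) tl_rho in \<open>auto simp: chains_def simplices_def\<close>)
  also have "\<dots> = z" using x(3) by (simp add: D_Suc D'_def)
  finally show "\<exists>y \<in> chains (Tp m) q. bd y = 0 \<and> map_point tl y = z" using rx rb by blast
qed

lemma rho_bd: "c \<in> chains (T (Suc m)) q \<Longrightarrow> map_point rho (bd c) = bd (map_point rho c)"
  by (rule map_point_bd[OF stable_T]) (use rho_closed rho_act T_lists Tp_T in blast)+

text \<open>Only the first two faces occur in \<open>D 2\<close>, so its composite with
  \<open>rho\<close> is the difference of two retractions, between which \<open>turn\<close> is a
  natural transformation.\<close>

lemma rho_omit:
  assumes x: "x \<in> chains (T (Suc (Suc m))) q" "bd x = 0"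
  shows "\<exists>h \<in> chains (Tp m) (Suc q). map_point rho (D 2 x) = bd h"
proof -
  have cl: "rho (omit j t) \<in> Tp m" if "t \<in> T (Suc (Suc m))" "j \<le> Suc m" for t j
    using that by (intro rho_closed T_omit)
  have sub: "Tp m \<subseteq> {t. set t \<subseteq> V}" using Tp_T T_lists by blast
  have eq: "rho (omit j (map (a g) t)) = map (a g) (rho (omit j t))"
    if "t \<in> T (Suc (Suc m))" "j \<le> Suc m" "g \<in> carrier G" for t j g
    using rho_act[OF that(3) T_omit[OF that(1,2)]] by (simp add: omit_map)
  interpret H: action_bar_homotopy G "\<lambda>g. map (a g)" "{t. set t \<subseteq> V}" G "\<lambda>g. map (a g)" "{t. set t \<subseteq> V}"
    "\<lambda>g. g" "rho \<circ> omit 0" "\<lambda>g. g" "rho \<circ> omit (Suc 0)" "T (Suc (Suc m))" turn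
  proof unfold_locales
    fix t assume t: "t \<in> T (Suc (Suc m))"
    show "(rho \<circ> omit 0) t \<in> {t. set t \<subseteq> V}" "(rho \<circ> omit (Suc 0)) t \<in> {t. set t \<subseteq> V}"
      using cl[OF t, of 0] cl[OF t, of "Suc 0"] sub by auto
    show "(rho \<circ> omit 0) t = map (a (turn t)) ((rho \<circ> omit (Suc 0)) t)"
      using turn_rho[OF t] by simp
  qed (use stable_T eq[of _ 0] eq[of _ "Suc 0"] in \<open>auto simp: turn_closed turn_act\<close>)
  have F: "H.F0.push = map_point (rho \<circ> omit 0)" "H.F1.push = map_point (rho \<circ> omit (Suc 0))"
    by (simp_all add: H.F0.push_def H.F1.push_def map_point_def)
  have "map_point rho (D 2 x) = map_point (rho \<circ> omit 0) x - map_point (rho \<circ> omit (Suc 0)) x"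
    by (simp add: D_def numeral_2_eq_2 map_point_linear map_point_map_point)
  also have "\<dots> = bd (- H.prism x)"
    using H.bd_prism[OF x(1)] x(2) by (simp add: F H.prism_simps linear_simps)
  finally have "map_point rho (D 2 x) = bd (- H.prism x)" .
  moreover have "H.prism x \<in> chains (Tp m) (Suc q)"
    by (rule H.prism_chains[OF x(1)]) (use cl in auto)
  then have "- H.prism x \<in> chains (Tp m) (Suc q)" using chains_diff[OF chains_0, of "H.prism x"] by simp
  ultimately show ?thesis by blast
qed

text \<open>Subtracting \<open>bd e\<close> from \<open>y\<close> gives a cycle killed by
  \<open>D 1\<close>, hence equal to \<open>D 2 x\<close> for a cycle \<open>x\<close>. By
  \<open>rho_omit\<close> its image under \<open>rho\<close> is a boundary; since \<open>rho\<close>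
  fixes \<open>y\<close> and commutes with \<open>bd\<close>, so is \<open>y\<close>.\<close>

lemma inj_step:
  assumes L: "q = 0 \<or> lift_at (q - 1) (Suc (Suc m)) 2" and N: "Suc m < N"
  shows "inj_at q m"
  unfolding inj_at_def
proof (intro ballI impI)
  fix y b assume y: "y \<in> chains (Tp m) q" "bd y = 0"
    and b: "b \<in> chains (T m) (Suc q)" "map_point tl y = bd b"
  obtain e where e: "e \<in> chains (T (Suc m)) (Suc q)" "D 1 e = b"
    using exact[OF b(1), of 0] N by (auto simp: D_0)
  define y1 where "y1 = y - bd e"
  have y1: "y1 \<in> chains (T (Suc m)) q"
    using chains_Tp_T[OF y(1)] bd_chains[OF stable_T e(1)] by (simp add: y1_def chains_diff)
  have "D 1 y = bd b" using b(2) by (simp add: D_Suc D'_def)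
  then have "D 1 y1 = 0" using D_bd[OF e(1), of 1] e(2) by (simp add: y1_def D_linear)
  then obtain g where g: "g \<in> chains (T (Suc (Suc m))) q" "D 2 g = y1"
    using exact[OF y1, of 1] N by (auto simp: numeral_2_eq_2)
  have "bd y1 = 0" using y(2) bd_bd_T[OF e(1)] by (simp add: y1_def linear_simps)
  then obtain x where x: "x \<in> chains (T (Suc (Suc m))) q" "bd x = 0" "D 2 x = y1"
    using cycle_lift[OF L g(1)] g by auto
  obtain h where h: "h \<in> chains (Tp m) (Suc q)" "map_point rho y1 = bd h"
    using rho_omit[OF x(1,2)] x(3) by auto
  have "map_point rho y = map_point (\<lambda>t. t) y"
    by (rule map_point_cong) (use y(1) rho_id in \<open>auto simp: chains_def simplices_def\<close>)
  then have "y = map_point rho (y1 + bd e)" by (simp add: y1_def map_point_ident)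
  also have "\<dots> = bd (h + map_point rho e)" using rho_bd[OF e(1)] h(2) by (simp add: map_point_linear linear_simps)
  finally have "bd (h + map_point rho e) = y" by simp
  moreover have "h + map_point rho e \<in> chains (Tp m) (Suc q)"
    using h(1) map_point_chains[OF e(1), of rho] rho_closed by (auto intro: chains_add)
  ultimately show "\<exists>f \<in> chains (Tp m) (Suc q). bd f = y" by blast
qed

text \<open>Write \<open>bd b\<close> as \<open>D (Suc k) x\<close> for a cycle \<open>x\<close>,
  and \<open>x\<close> as \<open>D (Suc (Suc k)) y + bd f\<close> by \<open>row_exact\<close>.
  Consecutive differentials compose to zero, so \<open>D (Suc k) f\<close> has the same boundary as
  \<open>b\<close> and is killed by \<open>D k\<close>.\<close>

lemma lift_step:
  assumes L: "q = 0 \<or> lift_at (q - 1) (Suc m) (Suc k)" and S: "surj_at q (Suc m)" and I: "inj_at q m"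
    and "m < N" "k \<le> m"
  shows "lift_at q m k"
  unfolding lift_at_def
proof (intro ballI impI)
  fix b assume b: "b \<in> chains (T m) (Suc q)" "D k (bd b) = 0"
  have c: "bd b \<in> chains (T m) q" by (rule bd_chains[OF stable_T b(1)])
  obtain e where e: "e \<in> chains (T (Suc m)) q" "D (Suc k) e = bd b"
    using exact[OF c b(2)] assms by auto
  then obtain x where x: "x \<in> chains (T (Suc m)) q" "bd x = 0" "D (Suc k) x = bd b"
    using cycle_lift[OF L e(1)] bd_bd_T[OF b(1)] assms by auto
  obtain y f where y: "y \<in> chains (T (Suc (Suc m))) q"
    and f: "f \<in> chains (T (Suc m)) (Suc q)" and eq: "x = D (Suc (Suc k)) y + bd f"
    using row_exact[OF S I _ x(1,2) b(1) x(3)] assms by auto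
  have "bd b = bd (D (Suc k) f)"
    using x(3) D_D[OF y, of "Suc k"] D_bd[OF f, of "Suc k"] assms by (simp add: eq D_linear)
  moreover have "D k (D (Suc k) f) = 0" using D_D[OF f] assms by simp
  moreover have "D (Suc k) f \<in> chains (T m) (Suc q)" using D_chains[OF f, of "Suc k"] assms by simp
  ultimately show "\<exists>b' \<in> chains (T m) (Suc q). D k b' = 0 \<and> bd b' = bd b" by auto
qed

text \<open>The bounds fit exactly. For positive \<open>q\<close>, surjectivity at \<open>m\<close>
  uses lifting in degree \<open>q - 1\<close> at \<open>m + 1\<close>, and injectivity uses it at
  \<open>m + 2\<close>; lifting in degree \<open>q\<close> uses surjectivity at \<open>m + 1\<close>
  and injectivity at \<open>m\<close>.\<close>

lemma stability:
  "(\<forall>m. 2 * q + 2 + m \<le> N \<longrightarrow> surj_at q m) \<and> (\<forall>m. 2 * q + 3 + m \<le> N \<longrightarrow> inj_at q m) \<and>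
   (\<forall>m k. k \<le> m \<longrightarrow> 2 * q + 3 + m \<le> N \<longrightarrow> lift_at q m k)"
proof (induction q)
  case 0
  have S: "surj_at 0 m" if "2 + m \<le> N" for m using that by (intro surj_step) auto
  have I: "inj_at 0 m" if "3 + m \<le> N" for m using that by (intro inj_step) auto
  have "lift_at 0 m k" if "k \<le> m" "3 + m \<le> N" for m k using that S I by (intro lift_step) auto
  then show ?case using S I by auto
next
  case (Suc q)
  have L: "lift_at q m k" if "k \<le> m" "2 * q + 3 + m \<le> N" for m k using that Suc by blast
  have S: "surj_at (Suc q) m" if "2 * Suc q + 2 + m \<le> N" for m
    using that L by (intro surj_step) auto
  have I: "inj_at (Suc q) m" if "2 * Suc q + 3 + m \<le> N" for m
    using that L by (intro inj_step) auto
  have "lift_at (Suc q) m k" if "k \<le> m" "2 * Suc q + 3 + m \<le> N" for m k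
    using that S I L by (intro lift_step) auto
  then show ?case using S I by blast
qed

end

section \<open>Orthogonal projections and reflections over a Pythagorean field\<close>

lemma subseqs_Cons: "set (subseqs (v # t)) = Cons v ` set (subseqs t) \<union> set (subseqs t)"
  by (simp add: Let_def)

lemma self_in_subseqs: "t \<in> set (subseqs t)"
  by (induction t) (auto simp: subseqs_Cons simp del: subseqs.simps(2))

lemma subseqs_length_set: "s \<in> set (subseqs t) \<Longrightarrow> length s \<le> length t \<and> set s \<subseteq> set t"
proof (induction t arbitrary: s)
  case (Cons v t)
  then show ?case by (fastforce simp: subseqs_Cons simp del: subseqs.simps(2))
qed simp

lemma subseqs_map: "subseqs (map f t) = map (map f) (subseqs t)"
  by (induction t) (auto simp: Let_def)

lemma subseqs_omit: "set (subseqs (omit j t)) \<subseteq> set (subseqs t)"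
proof (induction t arbitrary: j)
  case (Cons v t)
  then show ?case by (cases j) (auto simp: subseqs_Cons simp del: subseqs.simps(2))
qed (simp add: omit_def)

text \<open>
  Gram-Schmidt: for \<open>nondeg s\<close> this is the projection onto the orthogonal complement of \<open>s\<close>;
  otherwise it may involve divisions by zero.
\<close>

primrec orth_proj :: "'a::field vec list \<Rightarrow> 'a vec \<Rightarrow> 'a vec" where
  "orth_proj [] v = v"
| "orth_proj (u # s) v = orth_proj s v -
     ((orth_proj s v \<bullet> orth_proj s u) / (orth_proj s u \<bullet> orth_proj s u)) \<cdot>\<^sub>v orth_proj s u"

text \<open>Each \<open>orth_proj s v\<close> is the Gram-Schmidt vector of \<open>v\<close> over a
  subtuple \<open>s\<close>; when all are nonisotropic, every subtuple is independent with
  nondegenerate span. Quantifying over all subtuples keeps the condition stable under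
  \<open>omit\<close>.\<close>

primrec nondeg :: "'a::field vec list \<Rightarrow> bool" where
  "nondeg [] \<longleftrightarrow> True"
| "nondeg (v # t) \<longleftrightarrow> nondeg t \<and> (\<forall>s \<in> set (subseqs t). orth_proj s v \<bullet> orth_proj s v \<noteq> 0)"

definition refl_mat :: "'a::field vec \<Rightarrow> 'a mat" where
  "refl_mat v = mat (dim_vec v) (dim_vec v)
     (\<lambda>(i, j). (if i = j then 1 else 0) - 2 * v $ i * v $ j / (v \<bullet> v))"

text \<open>
  The value at \<open>1\<close> is fixed so that \<open>normalise\<close> leaves unit vectors unchanged.
\<close>

definition sqroot :: "'a::field \<Rightarrow> 'a" where
  "sqroot c = (if c = 1 then 1 else SOME z. z\<^sup>2 = c)"

definition normalise :: "'a::field vec \<Rightarrow> 'a vec" where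
  "normalise v = (1 / sqroot (v \<bullet> v)) \<cdot>\<^sub>v v"

lemma nondeg_subseqs: "nondeg t \<Longrightarrow> s \<in> set (subseqs t) \<Longrightarrow> nondeg s"
proof (induction t arbitrary: s)
  case (Cons v t)
  have "set (subseqs s') \<subseteq> set (subseqs t)" if "s' \<in> set (subseqs t)" for s'
    using that
  proof (induction t arbitrary: s')
    case (Cons w t)
    then show ?case by (fastforce simp: subseqs_Cons simp del: subseqs.simps(2))
  qed simp
  then show ?case using Cons by (fastforce simp: subseqs_Cons simp del: subseqs.simps(2))
qed simp

lemma nondeg_omit: "nondeg t \<Longrightarrow> nondeg (omit j t)"
  using nondeg_subseqs[of t "omit j t"] subseqs_omit[of j t] self_in_subseqs by blast

lemma mat_eq_by_vec:
  fixes A B :: "'a::field mat"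
  assumes "A \<in> carrier_mat n n" "B \<in> carrier_mat n n"
    and "\<And>x. x \<in> carrier_vec n \<Longrightarrow> A *\<^sub>v x = B *\<^sub>v x"
  shows "A = B"
proof (rule eq_matI)
  fix i j assume ij: "i < dim_row B" "j < dim_col B"
  have "A $$ (i, j) = (A *\<^sub>v unit_vec n j) $ i" "B $$ (i, j) = (B *\<^sub>v unit_vec n j) $ i"
    using ij assms(1,2) by (simp_all add: scalar_prod_right_unit)
  then show "A $$ (i, j) = B $$ (i, j)" using assms(3)[of "unit_vec n j"] by simp
qed (use assms in auto)

section \<open>Orthogonal maps and reflections\<close>

locale pythagorean_space =
  fixes n :: nat and ty :: "'a::field itself"
  assumes infinite_field: "infinite (UNIV :: 'a set)"
    and pythagorean: "pythagorean_field TYPE('a)"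
    and two: "(2 :: 'a) \<noteq> 0"
begin

abbreviation V :: "'a vec set" where "V \<equiv> carrier_vec n"

lemmas ip_simps =
  add_scalar_prod_distrib[where n = n] scalar_prod_add_distrib[where n = n]
  minus_scalar_prod_distrib[where n = n] scalar_prod_minus_distrib[where n = n]
  smult_scalar_prod_distrib[where n = n] scalar_prod_smult_distrib[where n = n]

lemma euclidean_form_eq: "euclidean_form v = v \<bullet> v"
  by (simp add: euclidean_form_def scalar_prod_def power2_eq_square atLeast0LessThan)

definition Orth :: "'a mat set" where
  "Orth = carrier (O_group TYPE('a) n)"

lemma Orth_iff: "A \<in> Orth \<longleftrightarrow> A \<in> carrier_mat n n \<and> invertible_mat A \<and>
    (\<forall>x \<in> V. (A *\<^sub>v x) \<bullet> (A *\<^sub>v x) = x \<bullet> x)"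
  by (auto simp: Orth_def orthogonal_group_def euclidean_form_eq)

lemma Orth_carrier: "A \<in> Orth \<Longrightarrow> A \<in> carrier_mat n n"
  by (simp add: Orth_iff)

lemma Orth_vec: "A \<in> Orth \<Longrightarrow> x \<in> V \<Longrightarrow> A *\<^sub>v x \<in> V"
  using Orth_carrier by (auto intro: mult_mat_vec_carrier)

lemma Orth_scalar_prod:
  assumes "A \<in> Orth" "x \<in> V" "y \<in> V"
  shows "(A *\<^sub>v x) \<bullet> (A *\<^sub>v y) = x \<bullet> y"
proof -
  have c: "A *\<^sub>v x \<in> V" "A *\<^sub>v y \<in> V" using assms Orth_vec by auto
  have "(A *\<^sub>v (x + y)) \<bullet> (A *\<^sub>v (x + y)) = (x + y) \<bullet> (x + y)"
    using assms by (simp add: Orth_iff)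
  moreover have "A *\<^sub>v (x + y) = A *\<^sub>v x + A *\<^sub>v y"
    using assms Orth_carrier by (intro mult_add_distrib_mat_vec) auto
  moreover have "(A *\<^sub>v x) \<bullet> (A *\<^sub>v x) = x \<bullet> x" "(A *\<^sub>v y) \<bullet> (A *\<^sub>v y) = y \<bullet> y"
    using assms by (auto simp: Orth_iff)
  ultimately have "2 * ((A *\<^sub>v x) \<bullet> (A *\<^sub>v y)) = 2 * (x \<bullet> y)"
    using assms c comm_scalar_prod[OF c] comm_scalar_prod[OF assms(2,3)]
    by (simp add: ip_simps algebra_simps)
  then show ?thesis using two by simp
qed

lemma refl_mat_carrier: "v \<in> V \<Longrightarrow> refl_mat v \<in> carrier_mat n n"
  by (auto simp: refl_mat_def)

lemma refl_mat_vec: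
  assumes "v \<in> V" "x \<in> V"
  shows "refl_mat v *\<^sub>v x = x - (2 * (v \<bullet> x) / (v \<bullet> v)) \<cdot>\<^sub>v v"
proof (rule eq_vecI)
  fix i assume "i < dim_vec (x - (2 * (v \<bullet> x) / (v \<bullet> v)) \<cdot>\<^sub>v v)"
  then have i: "i < n" using assms by simp
  have "(refl_mat v *\<^sub>v x) $ i =
    (\<Sum>j\<in>{0..<n}. ((if i = j then 1 else 0) - 2 * v $ i * v $ j / (v \<bullet> v)) * x $ j)"
    using i assms by (auto simp: refl_mat_def scalar_prod_def)
  also have "\<dots> = (\<Sum>j\<in>{0..<n}. (if i = j then x $ j else 0) - 2 * v $ i / (v \<bullet> v) * (v $ j * x $ j))"
    by (rule sum.cong) (auto simp: algebra_simps)
  also have "\<dots> = x $ i - 2 * v $ i / (v \<bullet> v) * (v \<bullet> x)"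
    using i assms by (simp add: sum_subtractf sum_distrib_left scalar_prod_def[of v x])
  finally show "(refl_mat v *\<^sub>v x) $ i = (x - (2 * (v \<bullet> x) / (v \<bullet> v)) \<cdot>\<^sub>v v) $ i"
    using i assms by simp
qed (use assms in \<open>auto simp: refl_mat_def\<close>)

lemma refl_mat_norm:
  assumes "v \<in> V" "x \<in> V" "v \<bullet> v \<noteq> 0"
  shows "(refl_mat v *\<^sub>v x) \<bullet> (refl_mat v *\<^sub>v x) = x \<bullet> x"
proof -
  define c where "c = 2 * (v \<bullet> x) / (v \<bullet> v)"
  have c: "c * (v \<bullet> v) = 2 * (v \<bullet> x)" using assms by (simp add: c_def)
  have "(x - c \<cdot>\<^sub>v v) \<bullet> (x - c \<cdot>\<^sub>v v) = x \<bullet> x - 2 * c * (v \<bullet> x) + c * (c * (v \<bullet> v))"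
    using assms comm_scalar_prod[OF assms(1,2)] by (simp add: ip_simps algebra_simps)
  then show ?thesis using refl_mat_vec[OF assms(1,2)] by (simp add: c c_def[symmetric])
qed

lemma refl_mat_invol:
  assumes "v \<in> V" "v \<bullet> v \<noteq> 0"
  shows "refl_mat v * refl_mat v = 1\<^sub>m n"
proof (rule mat_eq_by_vec[where n = n])
  fix x :: "'a vec" assume x: "x \<in> V"
  define c where "c = 2 * (v \<bullet> x) / (v \<bullet> v)"
  have y: "x - c \<cdot>\<^sub>v v \<in> V" using x assms by auto
  have "2 * (v \<bullet> (x - c \<cdot>\<^sub>v v)) / (v \<bullet> v) = - c"
    using x assms by (simp add: ip_simps c_def field_simps)
  then have "refl_mat v *\<^sub>v (refl_mat v *\<^sub>v x) = x - c \<cdot>\<^sub>v v - (- c) \<cdot>\<^sub>v v"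
    using refl_mat_vec[OF assms(1) x] refl_mat_vec[OF assms(1) y] by (simp add: c_def)
  also have "\<dots> = x" using x assms by (intro eq_vecI) auto
  finally show "refl_mat v * refl_mat v *\<^sub>v x = 1\<^sub>m n *\<^sub>v x"
    using x refl_mat_carrier[OF assms(1)] by simp
qed (use refl_mat_carrier[OF assms(1)] in auto)

lemma refl_mat_Orth:
  assumes "v \<in> V" "v \<bullet> v \<noteq> 0" shows "refl_mat v \<in> Orth"
proof -
  have "invertible_mat (refl_mat v)"
    using refl_mat_carrier[OF assms(1)] refl_mat_invol[OF assms]
    by (auto simp: invertible_mat_def inverts_mat_def intro!: exI[of _ "refl_mat v"])
  then show ?thesis using assms refl_mat_carrier refl_mat_norm by (auto simp: Orth_iff)
qed

text \<open>Conjugation of a reflection, written without inverses to fit the naturality condition of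
  \<open>action_bar_homotopy\<close>.\<close>

lemma Orth_refl_mat:
  assumes "g \<in> Orth" "v \<in> V"
  shows "refl_mat (g *\<^sub>v v) * g = g * refl_mat v"
proof (rule mat_eq_by_vec[where n = n])
  have g: "g \<in> carrier_mat n n" and gv: "g *\<^sub>v v \<in> V" using assms Orth_carrier Orth_vec by auto
  note r = refl_mat_carrier[OF gv] refl_mat_carrier[OF assms(2)]
  show "refl_mat (g *\<^sub>v v) * g \<in> carrier_mat n n" "g * refl_mat v \<in> carrier_mat n n" using r g by auto
  fix x :: "'a vec" assume x: "x \<in> V"
  have gx: "g *\<^sub>v x \<in> V" using x g by auto
  have "refl_mat (g *\<^sub>v v) *\<^sub>v (g *\<^sub>v x) = g *\<^sub>v (refl_mat v *\<^sub>v x)"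
    using refl_mat_vec[OF gv gx] refl_mat_vec[OF assms(2) x] x assms g
    by (simp add: Orth_scalar_prod mult_minus_distrib_mat_vec[OF g] mult_mat_vec[OF g])
  then show "refl_mat (g *\<^sub>v v) * g *\<^sub>v x = g * refl_mat v *\<^sub>v x" using x g r by simp
qed

lemma refl_mat_smult:
  assumes "v \<in> V" "k \<noteq> 0"
  shows "refl_mat (k \<cdot>\<^sub>v v) = refl_mat v"
  using assms by (intro eq_matI) (auto simp: refl_mat_def ip_simps field_simps)

text \<open>The reflections are conjugate by the reflection in \<open>u - v\<close>, which sends
  \<open>u\<close> to \<open>v\<close>, or by the one in \<open>u + v\<close>, which sends
  \<open>u\<close> to \<open>-v\<close>. The norms of \<open>u - v\<close> and \<open>u + v\<close>
  add up to \<open>4 (v . v)\<close>, so one of them is nonzero.\<close>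

lemma det_refl_mat_eq_norm:
  assumes u: "u \<in> V" and v: "v \<in> V" and eq: "u \<bullet> u = v \<bullet> v" and nz: "v \<bullet> v \<noteq> 0"
  shows "det (refl_mat u) = det (refl_mat v)"
proof -
  have key: "det (refl_mat u) = det (refl_mat v)"
    if h: "h \<in> Orth" and hu: "refl_mat (h *\<^sub>v u) = refl_mat v" for h
  proof -
    have hc: "h \<in> carrier_mat n n" using h by (rule Orth_carrier)
    have "det h \<noteq> 0"
    proof
      assume "det h = 0"
      obtain b where "h * b = 1\<^sub>m n" "b * h = 1\<^sub>m (dim_row b)"
        using h hc by (auto simp: Orth_iff invertible_mat_def inverts_mat_def)
      then have "b \<in> carrier_mat n n" using hc
        by (metis carrier_matD(2) carrier_matI index_mult_mat(3) index_one_mat(3))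
      then have "det h * det b = 1" using \<open>h * b = 1\<^sub>m n\<close> det_mult[OF hc] by (metis det_one)
      then show False using \<open>det h = 0\<close> by simp
    qed
    moreover have "det (refl_mat v) * det h = det h * det (refl_mat u)"
      using Orth_refl_mat[OF h u] det_mult[OF refl_mat_carrier[OF v] hc]
        det_mult[OF hc refl_mat_carrier[OF u]] unfolding hu by metis
    ultimately show ?thesis by (metis mult.commute mult_cancel_left)
  qed
  have uv: "v \<bullet> u = u \<bullet> v" using comm_scalar_prod[OF v u] .
  have m: "(u - v) \<bullet> (u - v) = 2 * (v \<bullet> v - u \<bullet> v)" and mu: "(u - v) \<bullet> u = v \<bullet> v - u \<bullet> v"
    and p: "(u + v) \<bullet> (u + v) = 2 * (v \<bullet> v + u \<bullet> v)" and pu: "(u + v) \<bullet> u = v \<bullet> v + u \<bullet> v"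
    using u v by (simp_all add: ip_simps eq uv algebra_simps)
  show ?thesis
  proof (cases "v \<bullet> v - u \<bullet> v = 0")
    case False
    then have w: "(u - v) \<bullet> (u - v) \<noteq> 0" using m two by simp
    have "refl_mat (u - v) *\<^sub>v u = u - (u - v)"
      using refl_mat_vec[of "u - v" u] u v False two by (simp add: m mu)
    also have "\<dots> = v" using u v by (intro eq_vecI) auto
    finally show ?thesis using key[OF refl_mat_Orth[OF _ w]] u v by simp
  next
    case True
    then have e: "v \<bullet> v + u \<bullet> v = 2 * (v \<bullet> v)" by simp
    then have "v \<bullet> v + u \<bullet> v \<noteq> 0" using two nz by simp
    then have w: "(u + v) \<bullet> (u + v) \<noteq> 0" using two unfolding p by (metis mult_eq_0_iff)
    have "2 * ((u + v) \<bullet> u) / ((u + v) \<bullet> (u + v)) = 1" using w unfolding p pu by (rule divide_self)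
    then have "refl_mat (u + v) *\<^sub>v u = u - (u + v)"
      using refl_mat_vec[of "u + v" u] u v by simp
    also have "\<dots> = (- 1) \<cdot>\<^sub>v v" using u v by (intro eq_vecI) auto
    finally show ?thesis using key[OF refl_mat_Orth[OF _ w]] u v by (simp add: refl_mat_smult)
  qed
qed

text \<open>The Pythagorean hypothesis, iterated over the coordinates; this is what allows
  nonisotropic vectors to be normalised.\<close>

lemma norm_square: "v \<in> V \<Longrightarrow> \<exists>z. v \<bullet> v = z\<^sup>2"
proof -
  have "\<exists>z. (\<Sum>j<m. (f j)\<^sup>2) = z\<^sup>2" for f :: "nat \<Rightarrow> 'a" and m
  proof (induction m)
    case 0 then show ?case by (auto intro: exI[of _ 0])
  next
    case (Suc m)
    then show ?case using pythagorean unfolding pythagorean_field_def by auto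
  qed
  then show ?thesis using euclidean_form_eq[of v] unfolding euclidean_form_def by metis
qed

lemma sqroot: "v \<in> V \<Longrightarrow> (sqroot (v \<bullet> v))\<^sup>2 = v \<bullet> v"
  using someI_ex[of "\<lambda>z. z\<^sup>2 = v \<bullet> v"] norm_square[of v] unfolding sqroot_def
  by (smt (verit) power_one)

lemma normalise_V: "v \<in> V \<Longrightarrow> normalise v \<in> V"
  by (simp add: normalise_def)

lemma normalise_unit:
  assumes "v \<in> V" "v \<bullet> v \<noteq> 0" shows "normalise v \<bullet> normalise v = 1"
proof -
  have "sqroot (v \<bullet> v) \<noteq> 0" using sqroot[OF assms(1)] assms(2) by auto
  then show ?thesis using assms sqroot[OF assms(1)]
    by (simp add: normalise_def ip_simps power2_eq_square field_simps)
qed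

lemma normalise_id: "v \<bullet> v = 1 \<Longrightarrow> normalise v = v"
  by (simp add: normalise_def sqroot_def)

lemma normalise_Orth: "g \<in> Orth \<Longrightarrow> v \<in> V \<Longrightarrow> normalise (g *\<^sub>v v) = g *\<^sub>v normalise v"
  by (simp add: normalise_def Orth_scalar_prod mult_mat_vec[OF Orth_carrier])

lemma refl_mat_unit: "0 < n \<Longrightarrow> refl_mat (unit_vec n 0) = (reflection_matrix n :: 'a mat)"
  by (intro eq_matI) (auto simp: refl_mat_def reflection_matrix_def)

lemma det_reflection_matrix: "0 < n \<Longrightarrow> det (reflection_matrix n :: 'a mat) = - 1"
proof -
  assume n: "0 < n"
  have "upper_triangular (reflection_matrix n :: 'a mat)"
    by (auto simp: reflection_matrix_def upper_triangular_def)
  then have "det (reflection_matrix n :: 'a mat) = prod_list (diag_mat (reflection_matrix n))"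
    by (rule det_upper_triangular[where n = n]) (simp add: reflection_matrix_def)
  also have "diag_mat (reflection_matrix n :: 'a mat) = map (\<lambda>i. if i = 0 then -1 else 1) [0..<n]"
    by (auto simp: diag_mat_def reflection_matrix_def)
  also have "prod_list \<dots> = (\<Prod>i<n. if i = 0 then -1 else 1)"
    by (simp add: prod.list_conv_set_nth atLeast0LessThan)
  also have "\<dots> = - 1" using n by (simp add: prod.delta)
  finally show ?thesis .
qed

text \<open>Normalising \<open>v\<close> does not change the reflection, and all reflections in unit
  vectors share the determinant of \<open>reflection_matrix n\<close>.\<close>

lemma det_refl_mat:
  assumes "v \<in> V" "v \<bullet> v \<noteq> 0"
  shows "det (refl_mat v) = - 1"
proof -
  have n: "0 < n" using assms by (cases n) (auto simp: scalar_prod_def)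
  have "sqroot (v \<bullet> v) \<noteq> 0" using sqroot[OF assms(1)] assms(2) by auto
  then have "refl_mat v = refl_mat (normalise v)"
    using refl_mat_smult[OF assms(1)] by (simp add: normalise_def)
  also have "det \<dots> = det (refl_mat (unit_vec n 0 :: 'a vec))"
    using n by (intro det_refl_mat_eq_norm) (auto simp: normalise_V normalise_unit assms)
  finally show ?thesis using n by (simp add: refl_mat_unit det_reflection_matrix)
qed

section \<open>Gram-Schmidt projections and generic vectors\<close>

lemma orth_proj_V: "v \<in> V \<Longrightarrow> set s \<subseteq> V \<Longrightarrow> orth_proj s v \<in> V"
  by (induction s arbitrary: v) auto

lemma orth_proj_Orth:
  assumes "g \<in> Orth" "v \<in> V" "set s \<subseteq> V"
  shows "orth_proj (map ((*\<^sub>v) g) s) (g *\<^sub>v v) = g *\<^sub>v orth_proj s v"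
  using assms(2,3)
proof (induction s arbitrary: v)
  case (Cons u s)
  have g: "g \<in> carrier_mat n n" using assms(1) by (rule Orth_carrier)
  show ?case using Cons assms(1)
    by (simp add: orth_proj_V Orth_scalar_prod mult_minus_distrib_mat_vec[OF g] mult_mat_vec[OF g])
qed simp

lemma orth_proj_add_smult:
  assumes "v \<in> V" "w \<in> V" "set s \<subseteq> V"
  shows "orth_proj s (v + k \<cdot>\<^sub>v w) = orth_proj s v + k \<cdot>\<^sub>v orth_proj s w"
  using assms
proof (induction s arbitrary: v w)
  case (Cons u s)
  have c: "orth_proj s v \<in> V" "orth_proj s w \<in> V" "orth_proj s u \<in> V" using Cons by (auto intro: orth_proj_V)
  then show ?case using Cons
    by (intro eq_vecI) (auto simp: ip_simps algebra_simps add_divide_distrib)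
qed simp

lemma scalar_prod_orth_proj:
  assumes "x \<in> V" "v \<in> V" "set s \<subseteq> V" "\<And>u. u \<in> set s \<Longrightarrow> x \<bullet> u = 0"
  shows "x \<bullet> orth_proj s v = x \<bullet> v"
  using assms by (induction s arbitrary: v) (auto simp: ip_simps orth_proj_V)

lemma orth_proj_id:
  assumes "x \<in> V" "set s \<subseteq> V" "\<And>u. u \<in> set s \<Longrightarrow> x \<bullet> u = 0"
  shows "orth_proj s x = x"
  using assms
proof (induction s)
  case (Cons u s)
  then have "x \<bullet> orth_proj s u = 0" using scalar_prod_orth_proj[of x u s] by auto
  moreover have "orth_proj s u \<in> V" using Cons.prems by (auto intro: orth_proj_V)
  ultimately show ?case using Cons by (intro eq_vecI) auto
qed simp

lemma orth_proj_orth: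
  assumes "nondeg s" "set s \<subseteq> V" "v \<in> V" "y \<in> set s"
  shows "orth_proj s v \<bullet> y = 0"
  using assms
proof (induction s arbitrary: v y)
  case (Cons u s)
  define v' where "v' = orth_proj s v"
  define u' where "u' = orth_proj s u"
  define p where "p = v' - ((v' \<bullet> u') / (u' \<bullet> u')) \<cdot>\<^sub>v u'"
  have "v' \<in> V" "u' \<in> V" using Cons.prems by (auto simp: v'_def u'_def intro: orth_proj_V)
  then have c: "v' \<in> V" "u' \<in> V" "u \<in> V" "p \<in> V" "set s \<subseteq> V" using Cons.prems by (auto simp: p_def)
  have u': "u' \<bullet> u' \<noteq> 0" using Cons.prems self_in_subseqs by (auto simp: u'_def)
  have s: "p \<bullet> z = 0" if "z \<in> set s" for z
  proof -
    have "v' \<bullet> z = 0" "u' \<bullet> z = 0" using Cons that by (auto simp: v'_def u'_def)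
    moreover have "z \<in> V" using that c by auto
    ultimately show ?thesis using c by (simp add: p_def ip_simps)
  qed
  \<comment> \<open>\<open>u\<close> and \<open>u'\<close> differ by a combination of
    \<open>s\<close>, to which \<open>p\<close> is orthogonal.\<close>
  have "p \<bullet> u = p \<bullet> u'"
    using scalar_prod_orth_proj[OF c(4) c(3) c(5)] s by (simp add: u'_def)
  also have "\<dots> = 0" using c u' by (simp add: p_def ip_simps)
  finally show ?case using Cons.prems(4) s by (auto simp: p_def v'_def u'_def)
qed simp

lemma nondeg_Orth: "g \<in> Orth \<Longrightarrow> set t \<subseteq> V \<Longrightarrow> nondeg t \<Longrightarrow> nondeg (map ((*\<^sub>v) g) t)"
proof (induction t)
  case (Cons v t)
  have "orth_proj (map ((*\<^sub>v) g) s) (g *\<^sub>v v) \<bullet> orth_proj (map ((*\<^sub>v) g) s) (g *\<^sub>v v) \<noteq> 0"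
    if "s \<in> set (subseqs t)" for s
  proof -
    have "set s \<subseteq> V" using subseqs_length_set[OF that] Cons.prems by auto
    then show ?thesis using Cons.prems that
      by (simp add: orth_proj_Orth Orth_scalar_prod orth_proj_V)
  qed
  then show ?case using Cons by (auto simp: subseqs_map)
qed simp

text \<open>Padding the rows \<open>s\<close> with zero rows gives a singular square matrix; any
  nonzero kernel vector will do.\<close>

lemma exists_orthogonal:
  assumes "set s \<subseteq> V" "length s < n"
  shows "\<exists>v \<in> V. v \<noteq> 0\<^sub>v n \<and> (\<forall>u \<in> set s. v \<bullet> u = 0)"
proof -
  define A where "A = mat_of_rows n (s @ replicate (n - length s) (0\<^sub>v n))"
  have A: "A \<in> carrier_mat n n" using assms by (auto simp: A_def)
  have row: "row A i = (s @ replicate (n - length s) (0\<^sub>v n)) ! i" if "i < n" for i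
    unfolding A_def using that assms by (intro mat_of_rows_row) (auto simp: nth_append subset_iff)
  have "det A = 0"
  proof (rule ccontr)
    assume "det A \<noteq> 0"
    \<comment> \<open>The last row is a padding row, so the last basis vector lies in the kernel of
      the transpose.\<close>
    have "A\<^sup>T *\<^sub>v unit_vec n (n - 1) = row A (n - 1)"
    proof (rule eq_vecI)
      fix i assume "i < dim_vec (row A (n - 1))"
      then show "(A\<^sup>T *\<^sub>v unit_vec n (n - 1)) $ i = row A (n - 1) $ i"
        using A assms by (auto simp: scalar_prod_right_unit)
    qed (use A in auto)
    also have "\<dots> = 0\<^sub>v n"
    proof -
      have "\<not> n - 1 < length s" using assms by linarith
      then show ?thesis using row[of "n - 1"] assms by (simp add: nth_append)
    qed
    finally have "A\<^sup>T *\<^sub>v unit_vec n (n - 1) = 0\<^sub>v n" .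
    moreover have "unit_vec n (n - 1) \<noteq> (0\<^sub>v n :: 'a vec)" using assms by (intro unit_vec_nonzero) auto
    ultimately have "det A\<^sup>T = 0" 
      using det_0_iff_vec_prod_zero_field[of "A\<^sup>T" n] A unit_vec_carrier transpose_carrier_mat by blast
    then show False using \<open>det A \<noteq> 0\<close> det_transpose[OF A] by simp
  qed
  then obtain v where v: "v \<in> V" "v \<noteq> 0\<^sub>v n" "A *\<^sub>v v = 0\<^sub>v n"
    using det_0_iff_vec_prod_zero_field[OF A] by auto
  have "v \<bullet> u = 0" if us: "u \<in> set s" for u
  proof -
    obtain i where i: "i < length s" "u = s ! i" using us by (auto simp: in_set_conv_nth)
    have "row A i \<bullet> v = (A *\<^sub>v v) $ i" using i assms A by simp
    also have "\<dots> = 0" using i assms v by simp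
    finally have "u \<bullet> v = 0" using row[of i] i assms by (simp add: nth_append)
    moreover have "u \<in> V" using us assms by auto
    ultimately show ?thesis using comm_scalar_prod v(1) by metis
  qed
  then show ?thesis using v by blast
qed

text \<open>Otherwise, by polarisation, the scalar product vanishes on all projections. A nonzero
  \<open>x\<close> orthogonal to \<open>s\<close> is its own projection and pairs with
  \<open>y\<close> as with the projection of \<open>y\<close>, so it would be orthogonal to
  everything.\<close>

lemma exists_nonisotropic:
  assumes "nondeg s" "set s \<subseteq> V" "length s < n"
  shows "\<exists>v \<in> V. orth_proj s v \<bullet> orth_proj s v \<noteq> 0"
proof (rule ccontr)
  assume "\<not> ?thesis"
  then have z: "orth_proj s v \<bullet> orth_proj s v = 0" if "v \<in> V" for v using that by auto
  obtain x where x: "x \<in> V" "x \<noteq> 0\<^sub>v n" "\<And>u. u \<in> set s \<Longrightarrow> x \<bullet> u = 0"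
    using exists_orthogonal[OF assms(2,3)] by auto
  have px: "orth_proj s x = x" using x assms by (intro orth_proj_id) auto
  have "x \<bullet> y = 0" if y: "y \<in> V" for y
  proof -
    have c: "orth_proj s y \<in> V" using y assms by (intro orth_proj_V)
    have "orth_proj s (x + 1 \<cdot>\<^sub>v y) = x + orth_proj s y"
      using orth_proj_add_smult[OF x(1) y assms(2), of 1] by (simp add: px)
    moreover have "x + 1 \<cdot>\<^sub>v y \<in> V" using x y by auto
    ultimately have "(x + orth_proj s y) \<bullet> (x + orth_proj s y) = 0" using z by metis
    moreover have "x \<bullet> x = 0" using z[OF x(1)] px by simp
    ultimately have "2 * (x \<bullet> orth_proj s y) = 0"
      using x c z[OF y] comm_scalar_prod[OF x(1) c] by (simp add: ip_simps algebra_simps)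
    then show ?thesis using two scalar_prod_orth_proj[OF x(1) y assms(2) x(3)] by simp
  qed
  then have "x $ i = 0" if "i < n" for i
    using that x(1) scalar_prod_right_unit[of i n x] unit_vec_carrier by metis
  then have "x = 0\<^sub>v n" using x(1) by (intro eq_vecI) auto
  then show False using x(2) by simp
qed

text \<open>Along a line \<open>v + k w\<close> each condition is a nonzero polynomial of degree at most two in \<open>k\<close>.\<close>

lemma exists_generic:
  assumes "finite R" "\<And>s. s \<in> R \<Longrightarrow> set s \<subseteq> V \<and> (\<exists>v \<in> V. orth_proj s v \<bullet> orth_proj s v \<noteq> 0)"
  shows "\<exists>v \<in> V. \<forall>s \<in> R. orth_proj s v \<bullet> orth_proj s v \<noteq> 0"
  using assms
proof (induction R)
  case empty
  have "0\<^sub>v n \<in> V" by simp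
  then show ?case by blast
next
  case (insert r R)
  obtain v where v: "v \<in> V" "\<And>s. s \<in> R \<Longrightarrow> orth_proj s v \<bullet> orth_proj s v \<noteq> 0" using insert by auto
  obtain w where w: "w \<in> V" "orth_proj r w \<bullet> orth_proj r w \<noteq> 0"
    using insert.prems[of r] by blast
  define p where "p s = [: orth_proj s v \<bullet> orth_proj s v, 2 * (orth_proj s v \<bullet> orth_proj s w),
    orth_proj s w \<bullet> orth_proj s w :]" for s
  \<comment> \<open>The constant coefficient of \<open>p s\<close> is nonzero for \<open>s\<close>
    in \<open>R\<close>, the leading one for \<open>s = r\<close>.\<close>
  have "finite {k. poly (p s) k = 0}" if "s \<in> insert r R" for s
    using that v(2) w(2) by (intro poly_roots_finite) (auto simp: p_def)
  then have "finite (\<Union>s \<in> insert r R. {k. poly (p s) k = 0})" using insert by blast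
  then obtain k where k: "\<And>s. s \<in> insert r R \<Longrightarrow> poly (p s) k \<noteq> 0"
    using infinite_field ex_new_if_finite by blast
  have "orth_proj s (v + k \<cdot>\<^sub>v w) \<bullet> orth_proj s (v + k \<cdot>\<^sub>v w) = poly (p s) k" if "s \<in> insert r R" for s
  proof -
    have s: "set s \<subseteq> V" using that insert by auto
    have c: "orth_proj s v \<in> V" "orth_proj s w \<in> V" using v w s by (auto intro: orth_proj_V)
    show ?thesis using c comm_scalar_prod[OF c]
      by (simp add: orth_proj_add_smult[OF v(1) w(1) s] p_def ip_simps algebra_simps)
  qed
  then show ?case using k v w by (intro bexI[of _ "v + k \<cdot>\<^sub>v w"]) auto
qed

end

section \<open>Configurations of vectors in general position\<close>

text \<open>This plays the part of \<open>rho\<close>.\<close>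

definition adjoin_proj :: "'a::field vec list \<Rightarrow> 'a vec list" where
  "adjoin_proj t = normalise (orth_proj (tl t) (hd t)) # tl t"

text \<open>The rotation in the plane of the unit vectors \<open>a\<close> and \<open>b\<close> that moves \<open>a\<close> to \<open>b\<close>.\<close>

definition rotation :: "'a::field vec \<Rightarrow> 'a vec \<Rightarrow> 'a mat" where
  "rotation a b = refl_mat (a + b) * refl_mat a"

text \<open>This plays the part of \<open>turn\<close>: it takes the unit vector obtained from the
  first entry to the one obtained from the second, both being orthogonal to the remaining
  entries.\<close>

definition plane_turn :: "'a::field vec list \<Rightarrow> 'a mat" where
  "plane_turn t = rotation (normalise (orth_proj (tl (tl t)) (hd t)))
     (normalise (orth_proj (tl (tl t)) (hd (tl t))))"

context pythagorean_space
begin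

definition T :: "nat \<Rightarrow> 'a vec list set" where
  "T m = {t. length t = m \<and> set t \<subseteq> V \<and> nondeg t}"

definition Tp :: "nat \<Rightarrow> 'a vec list set" where
  "Tp m = {w # t | w t. w \<in> V \<and> w \<bullet> w = 1 \<and> (\<forall>y \<in> set t. w \<bullet> y = 0) \<and> t \<in> T m}"

abbreviation G :: "'a mat monoid" where "G \<equiv> SO_group TYPE('a) n"

lemma carrier_G: "A \<in> carrier G \<longleftrightarrow> A \<in> Orth \<and> det A = 1"
  and mult_G: "A \<otimes>\<^bsub>G\<^esub> B = A * B" and one_G: "\<one>\<^bsub>G\<^esub> = 1\<^sub>m n"
  by (simp_all add: special_orthogonal_group_def Orth_def) (simp_all add: orthogonal_group_def)

lemma Orth_mult:
  assumes "A \<in> Orth" "B \<in> Orth" shows "A * B \<in> Orth"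
proof -
  have c: "A \<in> carrier_mat n n" "B \<in> carrier_mat n n" using assms Orth_carrier by auto
  obtain A' where A': "A * A' = 1\<^sub>m n" "A' * A = 1\<^sub>m (dim_row A')"
    using assms c by (auto simp: Orth_iff invertible_mat_def inverts_mat_def)
  obtain B' where B': "B * B' = 1\<^sub>m n" "B' * B = 1\<^sub>m (dim_row B')"
    using assms c by (auto simp: Orth_iff invertible_mat_def inverts_mat_def)
  have c': "A' \<in> carrier_mat n n" "B' \<in> carrier_mat n n" using A' B' c
    by (metis carrier_matD(2) carrier_matI index_mult_mat(3) index_one_mat(3))+
  have "(A * B) * (B' * A') = A * (B * B') * A'" "(B' * A') * (A * B) = B' * (A' * A) * B"
    using c c' by (simp_all add: assoc_mult_mat[of _ n n _ n _ n])
  then have "invertible_mat (A * B)" using A' B' c c'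
    by (auto simp: invertible_mat_def inverts_mat_def intro!: exI[of _ "B' * A'"])
  then show ?thesis using assms c by (auto simp: Orth_iff)
qed

lemma Orth_one: "1\<^sub>m n \<in> Orth"
  by (auto simp: Orth_iff invertible_mat_def inverts_mat_def intro!: exI[of _ "1\<^sub>m n"])

lemma monoid_G: "Group.monoid G"
proof (rule monoidI, unfold mult_G one_G)
  fix A B C assume A: "A \<in> carrier G" and B: "B \<in> carrier G" and C: "C \<in> carrier G"
  then have c: "A \<in> carrier_mat n n" "B \<in> carrier_mat n n" "C \<in> carrier_mat n n"
    by (auto simp: carrier_G Orth_carrier)
  show "A * B \<in> carrier G" using A B c by (simp add: carrier_G Orth_mult det_mult)
  show "A * B * C = A * (B * C)" using c by simp
  show "1\<^sub>m n * A = A" "A * 1\<^sub>m n = A" using c by simp_all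
qed (simp add: carrier_G Orth_one)

lemma refl_mat_prod_G:
  assumes "u \<in> V" "u \<bullet> u \<noteq> 0" "v \<in> V" "v \<bullet> v \<noteq> 0"
  shows "refl_mat u * refl_mat v \<in> carrier G"
  using assms by (simp add: carrier_G Orth_mult refl_mat_Orth det_refl_mat
      det_mult[OF refl_mat_carrier refl_mat_carrier])

text \<open>The reflection in \<open>a\<close> takes \<open>a\<close> to \<open>-a\<close>, and the
  one in \<open>a + b\<close> takes \<open>-a\<close> to \<open>b\<close>, as the norms agree. The
  norm of \<open>a + b\<close> is \<open>2 (1 + a . b)\<close>, so \<open>ab\<close> says that
  \<open>a + b\<close> is nonisotropic.\<close>

lemma rotation_props:
  assumes a: "a \<in> V" "a \<bullet> a = 1" and b: "b \<in> V" "b \<bullet> b = 1" and ab: "a \<bullet> b \<noteq> - 1"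
  shows "rotation a b \<in> carrier G" "rotation a b *\<^sub>v a = b"
    "\<And>x. x \<in> V \<Longrightarrow> a \<bullet> x = 0 \<Longrightarrow> b \<bullet> x = 0 \<Longrightarrow> rotation a b *\<^sub>v x = x"
    "\<And>g. g \<in> Orth \<Longrightarrow> rotation (g *\<^sub>v a) (g *\<^sub>v b) * g = g * rotation a b"
proof -
  define w where "w = a + b"
  have w: "w \<in> V" using a b by (simp add: w_def)
  have ww: "w \<bullet> w = 2 * (1 + a \<bullet> b)" and wa: "w \<bullet> a = 1 + a \<bullet> b"
    using a b comm_scalar_prod[OF a(1) b(1)] by (simp_all add: w_def ip_simps)
  have nz: "1 + a \<bullet> b \<noteq> 0" using ab by (simp add: add_eq_0_iff)
  then have ww0: "w \<bullet> w \<noteq> 0" using two unfolding ww by (metis mult_eq_0_iff)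
  have c: "refl_mat w \<in> carrier_mat n n" "refl_mat a \<in> carrier_mat n n"
    using w a refl_mat_carrier by auto
  show "rotation a b \<in> carrier G"
    unfolding rotation_def w_def[symmetric] using w ww0 a by (intro refl_mat_prod_G) auto
  have r: "rotation a b *\<^sub>v x = refl_mat w *\<^sub>v (refl_mat a *\<^sub>v x)" if "x \<in> V" for x
    unfolding rotation_def w_def[symmetric] using c that by simp
  have "refl_mat a *\<^sub>v a = (-1) \<cdot>\<^sub>v a" using refl_mat_vec[OF a(1) a(1)] a by (intro eq_vecI) auto
  then have ra: "rotation a b *\<^sub>v a = (-1) \<cdot>\<^sub>v (refl_mat w *\<^sub>v a)"
    using r[OF a(1)] mult_mat_vec[OF c(1) a(1)] by simp
  have "2 * (w \<bullet> a) / (w \<bullet> w) = 1" using ww0 unfolding ww wa by (rule divide_self)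
  then have "rotation a b *\<^sub>v a = (-1) \<cdot>\<^sub>v (a - w)" using refl_mat_vec[OF w a(1)] ra by simp
  also have "(-1) \<cdot>\<^sub>v (a - w) = b" using a b by (intro eq_vecI) (auto simp: w_def)
  finally show "rotation a b *\<^sub>v a = b" .
  show "rotation a b *\<^sub>v x = x" if x: "x \<in> V" "a \<bullet> x = 0" "b \<bullet> x = 0" for x
  proof -
    have "w \<bullet> x = 0" using a b x by (simp add: w_def ip_simps)
    then have "refl_mat w *\<^sub>v x = x - 0 \<cdot>\<^sub>v w" "refl_mat a *\<^sub>v x = x - 0 \<cdot>\<^sub>v a"
      using refl_mat_vec[OF w x(1)] refl_mat_vec[OF a(1) x(1)] x by auto
    moreover have "x - 0 \<cdot>\<^sub>v w = x" "x - 0 \<cdot>\<^sub>v a = x" using x w a by (auto intro!: eq_vecI)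
    ultimately show ?thesis using r[OF x(1)] by simp
  qed
  show "rotation (g *\<^sub>v a) (g *\<^sub>v b) * g = g * rotation a b" if g: "g \<in> Orth" for g
  proof -
    have gc: "g \<in> carrier_mat n n" using g by (rule Orth_carrier)
    have ga: "refl_mat (g *\<^sub>v a) \<in> carrier_mat n n" "refl_mat (g *\<^sub>v w) \<in> carrier_mat n n"
      using Orth_vec[OF g] a w refl_mat_carrier by auto
    have "g *\<^sub>v a + g *\<^sub>v b = g *\<^sub>v w"
      using mult_add_distrib_mat_vec[OF gc a(1) b(1)] by (simp add: w_def)
    then have "rotation (g *\<^sub>v a) (g *\<^sub>v b) * g = refl_mat (g *\<^sub>v w) * (refl_mat (g *\<^sub>v a) * g)"
      unfolding rotation_def using ga gc by simp
    also have "\<dots> = refl_mat (g *\<^sub>v w) * g * refl_mat a"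
      unfolding Orth_refl_mat[OF g a(1)] using ga gc c by simp
    also have "\<dots> = g * rotation a b"
      unfolding Orth_refl_mat[OF g w] rotation_def w_def[symmetric] using gc c by simp
    finally show ?thesis .
  qed
qed

section \<open>Verification of the configuration axioms\<close>

lemma T_Cons_unit:
  assumes "t \<in> T m" "v # t \<in> T (Suc m)"
  defines "a \<equiv> normalise (orth_proj t v)"
  shows "a \<in> V" "a \<bullet> a = 1" "\<And>y. y \<in> set t \<Longrightarrow> a \<bullet> y = 0"
proof -
  have t: "v \<in> V" "set t \<subseteq> V" "nondeg t" using assms by (auto simp: T_def)
  have p: "orth_proj t v \<in> V" using t by (intro orth_proj_V)
  have q: "orth_proj t v \<bullet> orth_proj t v \<noteq> 0" using assms self_in_subseqs by (auto simp: T_def)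
  show "a \<in> V" "a \<bullet> a = 1" using p q by (auto simp: a_def normalise_V normalise_unit)
  show "a \<bullet> y = 0" if "y \<in> set t" for y
    using orth_proj_orth[OF t(3,2,1) that] p t that by (auto simp: a_def normalise_def)
qed

text \<open>For the last claim let \<open>A\<close>, \<open>B\<close> be the projections of
  \<open>v\<close>, \<open>w\<close>. The value \<open>-1\<close> would give
  \<open>(A . B)^2 = (A . A) (B . B)\<close>, the equality case of Cauchy-Schwarz, and the
  projection of \<open>v\<close> away from \<open>w # t\<close> would be isotropic.\<close>

lemma T_Cons_Cons:
  assumes "v # w # t \<in> T (Suc (Suc m))"
  shows "t \<in> T m" "v # t \<in> T (Suc m)" "w # t \<in> T (Suc m)"
    "normalise (orth_proj t v) \<bullet> normalise (orth_proj t w) \<noteq> - 1"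
proof -
  show t: "t \<in> T m" and vt: "v # t \<in> T (Suc m)" and wt: "w # t \<in> T (Suc m)"
    using assms by (auto simp: T_def subseqs_Cons simp del: subseqs.simps(2))
  define A where "A = orth_proj t v"
  define B where "B = orth_proj t w"
  have c: "A \<in> V" "B \<in> V" using vt wt by (auto simp: A_def B_def T_def intro!: orth_proj_V)
  have nA: "A \<bullet> A \<noteq> 0" and nB: "B \<bullet> B \<noteq> 0"
    using vt wt self_in_subseqs by (auto simp: T_def A_def B_def)
  have "w # t \<in> set (subseqs (w # t))" by (rule self_in_subseqs)
  then have "orth_proj (w # t) v \<bullet> orth_proj (w # t) v \<noteq> 0" using assms by (auto simp: T_def)
  then have n: "(A - ((A \<bullet> B) / (B \<bullet> B)) \<cdot>\<^sub>v B) \<bullet> (A - ((A \<bullet> B) / (B \<bullet> B)) \<cdot>\<^sub>v B) \<noteq> 0"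
    by (simp add: A_def B_def)
  have eq: "(A - ((A \<bullet> B) / (B \<bullet> B)) \<cdot>\<^sub>v B) \<bullet> (A - ((A \<bullet> B) / (B \<bullet> B)) \<cdot>\<^sub>v B) =
    A \<bullet> A - (A \<bullet> B)\<^sup>2 / (B \<bullet> B)"
    using c nB comm_scalar_prod[OF c(2,1)] by (simp add: ip_simps power2_eq_square)
  show "normalise (orth_proj t v) \<bullet> normalise (orth_proj t w) \<noteq> - 1"
  proof
    define \<alpha> where "\<alpha> = sqroot (A \<bullet> A)"
    define \<beta> where "\<beta> = sqroot (B \<bullet> B)"
    have ab: "\<alpha>\<^sup>2 = A \<bullet> A" "\<beta>\<^sup>2 = B \<bullet> B" using c by (auto simp: \<alpha>_def \<beta>_def sqroot)
    then have nz: "\<alpha> \<noteq> 0" "\<beta> \<noteq> 0" using nA nB by auto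
    assume "normalise (orth_proj t v) \<bullet> normalise (orth_proj t w) = - 1"
    then have "(A \<bullet> B) / (\<alpha> * \<beta>) = - 1"
      using c by (simp add: normalise_def A_def[symmetric] B_def[symmetric] \<alpha>_def \<beta>_def mult.commute)
    then have "A \<bullet> B = - (\<alpha> * \<beta>)" using nz by (simp add: field_simps)
    then have "(A \<bullet> B)\<^sup>2 / (B \<bullet> B) = A \<bullet> A" using ab nB by (simp add: power_mult_distrib)
    then show False using n eq by simp
  qed
qed

lemma T_Orth: "g \<in> Orth \<Longrightarrow> t \<in> T m \<Longrightarrow> map ((*\<^sub>v) g) t \<in> T m"
  using Orth_vec by (auto simp: T_def intro!: nondeg_Orth)

lemma Tp_T: "t \<in> Tp m \<Longrightarrow> t \<in> T (Suc m)"
proof -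
  assume "t \<in> Tp m"
  then obtain w u where t: "t = w # u" "w \<in> V" "w \<bullet> w = 1" "\<forall>y \<in> set u. w \<bullet> y = 0" "u \<in> T m"
    by (auto simp: Tp_def)
  have "orth_proj s w = w" if "s \<in> set (subseqs u)" for s
    using subseqs_length_set[OF that] t by (intro orth_proj_id) (auto simp: T_def)
  then show "t \<in> T (Suc m)" using t by (auto simp: T_def)
qed

text \<open>Each subtuple of a member of \<open>S\<close> imposes one nonisotropy condition on
  \<open>v\<close>. These are finitely many, and each can be met separately because the subtuple has
  fewer than \<open>n\<close> entries.\<close>

lemma T_extend:
  assumes "finite S" "S \<subseteq> T m" "m < n"
  shows "\<exists>v. \<forall>t \<in> S. v # t \<in> T (Suc m)"
proof -
  have "finite (\<Union>t \<in> S. set (subseqs t))" using assms by auto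
  moreover have "set s \<subseteq> V \<and> (\<exists>v \<in> V. orth_proj s v \<bullet> orth_proj s v \<noteq> 0)"
    if s: "s \<in> (\<Union>t \<in> S. set (subseqs t))" for s
  proof -
    obtain t where t: "t \<in> S" "s \<in> set (subseqs t)" using s by auto
    then have "set t \<subseteq> V" "length t < n" "nondeg t" using assms by (auto simp: T_def)
    then have "set s \<subseteq> V" "length s < n" "nondeg s"
      using subseqs_length_set[OF t(2)] nondeg_subseqs[OF _ t(2)] by auto
    then show ?thesis using exists_nonisotropic by auto
  qed
  ultimately obtain v where "v \<in> V" "\<forall>s \<in> (\<Union>t \<in> S. set (subseqs t)). orth_proj s v \<bullet> orth_proj s v \<noteq> 0"
    using exists_generic by metis
  then have "\<forall>t \<in> S. v # t \<in> T (Suc m)" using assms by (auto simp: T_def)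
  then show ?thesis by blast
qed

sublocale frames: configurations G "(*\<^sub>v)" V T Tp adjoin_proj plane_turn n
proof -
  interpret Group.monoid G by (rule monoid_G)
  have O: "g \<in> carrier G \<Longrightarrow> g \<in> Orth" for g by (simp add: carrier_G)
  show "configurations G (*\<^sub>v) V T Tp adjoin_proj plane_turn n"
  proof unfold_locales
    fix g t assume "g \<in> carrier G" "t \<in> {t. set t \<subseteq> V}"
    then show "map ((*\<^sub>v) g) t \<in> {t. set t \<subseteq> V}" using Orth_vec[OF O] by auto
  next
    fix g h t assume a: "g \<in> carrier G" "h \<in> carrier G" "t \<in> {t. set t \<subseteq> V}"
    then have "g \<in> carrier_mat n n" "h \<in> carrier_mat n n" using O Orth_carrier by auto
    then show "map ((*\<^sub>v) (g \<otimes>\<^bsub>G\<^esub> h)) t = map ((*\<^sub>v) g) (map ((*\<^sub>v) h) t)"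
      using a by (auto simp: mult_G)
  next
    fix t m assume "t \<in> T m"
    then show "length t = m \<and> set t \<subseteq> V" by (simp add: T_def)
  next
    fix g t m assume "g \<in> carrier G" "t \<in> T m"
    then show "map ((*\<^sub>v) g) t \<in> T m" using T_Orth O by blast
  next
    fix t m j assume t: "t \<in> T (Suc m)" and j: "j \<le> m"
    have "set (omit j t) \<subseteq> set t" using set_take_subset set_drop_subset by (fastforce simp: omit_def)
    then show "omit j t \<in> T m" using t j nondeg_omit by (auto simp: T_def omit_def)
  next
    fix S m assume "finite S" "S \<subseteq> T m" "m < n"
    then show "\<exists>v. \<forall>t \<in> S. v # t \<in> T (Suc m)" by (rule T_extend)
  next
    fix t m assume "t \<in> Tp m" then show "t \<in> T (Suc m)" by (rule Tp_T)
  next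
    fix g t m assume g: "g \<in> carrier G" and "t \<in> Tp m"
    then obtain w u where t: "t = w # u" "w \<in> V" "w \<bullet> w = 1" "\<forall>y \<in> set u. w \<bullet> y = 0" "u \<in> T m"
      by (auto simp: Tp_def)
    then have "\<forall>y \<in> set u. y \<in> V" by (auto simp: T_def)
    then show "map ((*\<^sub>v) g) t \<in> Tp m" using t T_Orth[OF O[OF g] t(5)] O[OF g]
      by (auto simp: Tp_def Orth_vec Orth_scalar_prod)
  next
    fix t m j assume "t \<in> Tp (Suc m)" and j: "j \<le> m"
    then obtain w u where t: "t = w # u" "w \<in> V" "w \<bullet> w = 1" "\<forall>y \<in> set u. w \<bullet> y = 0" "u \<in> T (Suc m)"
      by (auto simp: Tp_def)
    have "set (omit j u) \<subseteq> set u" using set_take_subset set_drop_subset by (fastforce simp: omit_def)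
    moreover from this have "omit j u \<in> T m" using t j nondeg_omit by (auto simp: T_def omit_def)
    ultimately show "omit (Suc j) t \<in> Tp m" using t by (auto simp: Tp_def)
  next
    fix t m assume t: "t \<in> T (Suc m)"
    then obtain v u where u: "t = v # u" "u \<in> T m" by (cases t) (auto simp: T_def)
    then show "adjoin_proj t \<in> Tp m" using T_Cons_unit[of u m v] t by (auto simp: adjoin_proj_def Tp_def)
    show "tl (adjoin_proj t) = tl t" by (simp add: adjoin_proj_def)
    fix g assume "g \<in> carrier G"
    then show "adjoin_proj (map ((*\<^sub>v) g) t) = map ((*\<^sub>v) g) (adjoin_proj t)"
      using u t O by (auto simp: adjoin_proj_def T_def orth_proj_Orth normalise_Orth orth_proj_V)
  next
    fix t m assume "t \<in> Tp m"
    then show "adjoin_proj t = t"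
      by (auto simp: Tp_def T_def adjoin_proj_def orth_proj_id normalise_id)
  next
    fix t m assume t: "t \<in> T (Suc (Suc m))"
    then obtain v w u where u: "t = v # w # u" by (auto simp: T_def length_Suc_conv)
    note c = T_Cons_Cons[OF t[unfolded u]]
    note a = T_Cons_unit[OF c(1,2)] and b = T_Cons_unit[OF c(1,3)]
    note r = rotation_props[OF a(1,2) b(1,2) c(4)]
    have V: "set u \<subseteq> V" "v \<in> V" "w \<in> V" using t u by (auto simp: T_def)
    show "plane_turn t \<in> carrier G" using r(1) by (simp add: u plane_turn_def)
    have "rotation (normalise (orth_proj u v)) (normalise (orth_proj u w)) *\<^sub>v y = y" if "y \<in> set u" for y
      using that V a(3) b(3) by (intro r(3)) auto
    then show "adjoin_proj (omit 0 t) = map ((*\<^sub>v) (plane_turn t)) (adjoin_proj (omit (Suc 0) t))"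
      using r(2) by (simp add: u plane_turn_def adjoin_proj_def map_idI)
    fix g assume g: "g \<in> carrier G"
    show "plane_turn (map ((*\<^sub>v) g) t) \<otimes>\<^bsub>G\<^esub> g = g \<otimes>\<^bsub>G\<^esub> plane_turn t"
      using r(4)[OF O[OF g]] V O[OF g]
      by (simp add: u plane_turn_def mult_G orth_proj_Orth normalise_Orth orth_proj_V)
  qed
qed

definition refl0 :: "'a mat" where "refl0 = reflection_matrix n"

lemma refl0_props:
  assumes "0 < n"
  shows "refl0 \<in> carrier_mat n n" "refl0 * refl0 = 1\<^sub>m n" "refl0 \<in> Orth" "det refl0 = - 1"
    "refl0 = refl_mat (unit_vec n 0)"
proof -
  have u: "unit_vec n 0 \<in> V" "unit_vec n 0 \<bullet> unit_vec n 0 \<noteq> (0 :: 'a)"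
    using assms by auto
  show e: "refl0 = refl_mat (unit_vec n 0)" using refl_mat_unit[OF assms] by (simp add: refl0_def)
  show "refl0 \<in> carrier_mat n n" "refl0 * refl0 = 1\<^sub>m n" "refl0 \<in> Orth" "det refl0 = - 1"
    unfolding e using u refl_mat_carrier refl_mat_invol refl_mat_Orth det_refl_mat by auto
qed

lemma reflection_conj_eq:
  assumes "0 < n" shows "reflection_conj n g = refl0 * g * refl0"
proof -
  let ?O = "O_group TYPE('a) n"
  note p = refl0_props[OF assms]
  have m: "x \<otimes>\<^bsub>?O\<^esub> y = x * y" "\<one>\<^bsub>?O\<^esub> = 1\<^sub>m n" for x y :: "'a mat"
    by (simp_all add: orthogonal_group_def)
  have "inv\<^bsub>?O\<^esub> refl0 = refl0" unfolding m_inv_def m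
  proof (rule the_equality)
    show "refl0 \<in> carrier ?O \<and> refl0 * refl0 = 1\<^sub>m n \<and> refl0 * refl0 = 1\<^sub>m n"
      using p by (simp add: Orth_def)
    fix y assume y: "y \<in> carrier ?O \<and> refl0 * y = 1\<^sub>m n \<and> y * refl0 = 1\<^sub>m n"
    then have "y \<in> carrier_mat n n" using Orth_carrier by (simp add: Orth_def)
    then have "y = refl0 * refl0 * y" unfolding p(2) by simp
    also have "\<dots> = refl0 * (refl0 * y)" using p(1) \<open>y \<in> carrier_mat n n\<close> by (intro assoc_mult_mat) auto
    finally show "y = refl0" using y p by simp
  qed
  then show ?thesis by (simp add: reflection_conj_def m refl0_def)
qed

end

section \<open>Triviality of the involution\<close>

definition forget :: "('g list \<times> 'x \<Rightarrow>\<^sub>0 int) \<Rightarrow> ('g list \<Rightarrow>\<^sub>0 int)" where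
  "forget = frag_map fst"

text \<open>For a point \<open>x\<close> fixed by the group this identifies the integral bar complex
  with the chains on \<open>{x}\<close>.\<close>

definition attach :: "'x \<Rightarrow> ('g list \<Rightarrow>\<^sub>0 int) \<Rightarrow> ('g list \<times> 'x \<Rightarrow>\<^sub>0 int)" where
  "attach x = frag_map (\<lambda>gs. (gs, x))"

lemma forget_simps:
  "forget (a - b) = forget a - forget b" "forget 0 = 0"
  "forget (frag_of (gs, x)) = frag_of gs"
  by (simp_all add: forget_def frag_extend_diff)

lemma attach_simps:
  "attach x (a - b) = attach x a - attach x b" "attach x 0 = 0"
  "attach x (frag_of gs) = frag_of (gs, x)"
  by (simp_all add: attach_def frag_extend_diff)

lemma forget_attach: "forget (attach x c) = c"
  by (rule frag_map_eqI[of c UNIV "\<lambda>c. forget (attach x c)" "\<lambda>c. c"])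
     (auto simp: forget_simps attach_simps)

lemma forget_map_point: "forget (map_point f c) = forget c"
  by (rule frag_map_eqI[of c UNIV]) (auto simp: forget_simps map_point_linear)

lemma bar_boundary_linear:
  "bar_boundary G k (a - b) = bar_boundary G k a - bar_boundary G k b" "bar_boundary G k 0 = 0"
  by (simp_all add: bar_boundary_def frag_extend_diff)

context action_bar
begin

lemma forget_prepend:
  fixes c :: "'g list \<times> 'x \<Rightarrow>\<^sub>0 int"
  shows "forget (prepend g c) = frag_map (Cons g) (forget c)"
  by (rule frag_map_eqI[of c UNIV]) (auto simp: forget_simps linear_simps gen_simps frag_extend_diff)

text \<open>Matches the recursive faces with the indexed ones of \<open>bar_boundary\<close>. Face
  \<open>Suc j\<close> carries the sign \<open>(-1)^j\<close> because \<open>bd\<close> subtracts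
  the inner simplex.\<close>

lemma forget_inner_simplex:
  "forget (inner_simplex gs g x) =
    (\<Sum>j\<le>length gs. frag_cmul ((-1) ^ j) (frag_of (bar_face G (Suc j) (g # gs))))"
proof (induction gs arbitrary: g)
  case Nil
  then show ?case by (simp add: forget_simps bar_face_def)
next
  case (Cons h gs)
  have *: "bar_face G (Suc (Suc j)) (g # h # gs) = g # bar_face G (Suc j) (h # gs)" if "j \<le> length gs" for j
    using that by (simp add: bar_face_def)
  have "frag_map (Cons g) (forget (inner_simplex gs h x)) =
     (\<Sum>j\<le>length gs. frag_cmul ((-1) ^ j) (frag_of (g # bar_face G (Suc j) (h # gs))))"
    by (simp add: Cons.IH frag_extend_sum frag_extend_cmul)
  also have "\<dots> = (\<Sum>j\<le>length gs. frag_cmul ((-1) ^ j) (frag_of (bar_face G (Suc (Suc j)) (g # h # gs))))"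
    using * by (intro sum.cong) auto
  finally show ?case
    by (simp add: forget_simps forget_prepend sum.atMost_Suc_shift bar_face_def sum_negf[symmetric]
        del: sum.atMost_Suc)
qed

lemma forget_bd:
  assumes "c \<in> chains X q"
  shows "forget (bd c) = bar_boundary G q (forget c)"
proof (rule chains_eqI[OF assms])
  fix gs x assume *: "length gs = q" "set gs \<subseteq> carrier G" "x \<in> X"
  show "forget (bd (frag_of (gs, x))) = bar_boundary G q (forget (frag_of (gs, x)))"
  proof (cases gs)
    case Nil then show ?thesis using * by (simp add: forget_simps gen_simps bar_boundary_def)
  next
    case (Cons g r)
    have "bar_face G 0 gs = r" by (simp add: Cons bar_face_def)
    then show ?thesis using * Cons
      by (auto simp: forget_simps gen_simps bar_boundary_def forget_inner_simplex
        sum.atMost_Suc_shift sum_negf[symmetric] simp del: sum.atMost_Suc)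
  qed
qed (auto simp: forget_simps linear_simps bar_boundary_linear)

lemma forget_carrier: "c \<in> chains X q \<Longrightarrow> forget c \<in> carrier (bar_chain_group G q)"
  using keys_frag_extend[of "\<lambda>x. frag_of (fst x)" c]
  by (fastforce simp: forget_def bar_chain_group_def chains_def simplices_def)

lemma attach_chains:
  assumes "c \<in> carrier (bar_chain_group G q)" "x \<in> X"
  shows "attach x c \<in> chains X q"
  using keys_frag_extend[of "\<lambda>gs. frag_of (gs, x)" c] assms
  by (fastforce simp: attach_def bar_chain_group_def chains_def simplices_def)

lemma attach_forget: "c \<in> chains {x} q \<Longrightarrow> attach x (forget c) = c"
  by (rule chains_eqI[of c "{x}" q "\<lambda>c. attach x (forget c)" "\<lambda>c. c"])
     (auto simp: forget_simps attach_simps)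

text \<open>\<open>forget\<close> is injective on chains over a single point, so the boundary may be
  tested after forgetting.\<close>

lemma bd_attach:
  assumes "stable {x}" "c \<in> bar_cycles G q"
  shows "bd (attach x c) = 0"
proof (cases q)
  case 0
  then show ?thesis using assms attach_chains[of c q x "{x}"] bd_chains_0 by (auto simp: bar_cycles_def)
next
  case (Suc p)
  have c: "attach x c \<in> chains {x} q" using assms by (auto simp: bar_cycles_def intro: attach_chains)
  then have "forget (bd (attach x c)) = 0"
    using assms(2) by (simp add: forget_bd forget_attach bar_cycles_def)
  moreover have "bd (attach x c) \<in> chains {x} p" using bd_chains[OF assms(1)] c Suc by simp
  ultimately show ?thesis using attach_forget attach_simps(2) by metis
qed

text \<open>Forgetting points maps the action groupoid of \<open>X\<close> to the group itself, and
  \<open>s\<close> is a natural transformation from this functor to its composite with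
  \<open>phi\<close>. For constant \<open>s\<close> this is the triviality of inner automorphisms in
  homology.\<close>

lemma conjugation_boundary:
  assumes X: "stable X" and s: "\<And>x. x \<in> X \<Longrightarrow> s x \<in> carrier G"
    and phi: "\<And>g. g \<in> carrier G \<Longrightarrow> phi g \<in> carrier G"
      "\<And>g h. g \<in> carrier G \<Longrightarrow> h \<in> carrier G \<Longrightarrow> phi (g \<otimes> h) = phi g \<otimes> phi h"
    and conj: "\<And>g x. g \<in> carrier G \<Longrightarrow> x \<in> X \<Longrightarrow> s (act g x) \<otimes> g = phi g \<otimes> s x"
    and y: "y \<in> chains X q" "bd y = 0"
  shows "frag_map (map phi) (forget y) - forget y \<in> bar_boundaries G q"
proof -
  interpret P: action_bar G "\<lambda>g x. ()" "UNIV :: unit set" by unfold_locales auto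
  interpret H: action_bar_homotopy G act U G "\<lambda>g x. ()" "UNIV :: unit set" phi "\<lambda>_. ()" "\<lambda>g. g" "\<lambda>_. ()" X s
    by unfold_locales (use X s phi conj in auto)
  have "P.bd (H.prism y) = H.F1.push y - H.F0.push y"
    using H.bd_prism[OF y(1)] y(2) by (simp add: H.prism_simps)
  then have eq: "H.F0.push y - H.F1.push y = P.bd (- H.prism y)" by (simp add: P.linear_simps)
  have "H.prism y \<in> P.chains UNIV (Suc q)" by (rule H.prism_chains[OF y(1) subset_UNIV])
  then have c: "- H.prism y \<in> P.chains UNIV (Suc q)" using P.chains_diff[OF P.chains_0] by fastforce
  have "forget (H.F0.push y) = frag_map (map phi) (forget y)"
    by (rule frag_map_eqI[of y UNIV]) (auto simp: forget_simps H.F0.push_simps frag_extend_diff)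
  moreover have "forget (H.F1.push y) = forget y"
    by (rule frag_map_eqI[of y UNIV]) (auto simp: forget_simps H.F1.push_simps)
  ultimately have "frag_map (map phi) (forget y) - forget y = forget (P.bd (- H.prism y))"
    unfolding eq[symmetric] by (simp add: forget_simps)
  also have "\<dots> = bar_boundary G (Suc q) (forget (- H.prism y))" by (rule P.forget_bd[OF c])
  finally show ?thesis using P.forget_carrier[OF c] by (auto simp: bar_boundaries_def)
qed

end

lemma (in Group.monoid) induced_identity:
  assumes triv: "\<And>z. z \<in> bar_cycles G q \<Longrightarrow> frag_map (map phi) z - z \<in> bar_boundaries G q"
    and X: "X \<in> carrier (group_homology G q)"
  shows "group_homology_induced G G q phi X = X"
proof -
  interpret P: action_bar G "\<lambda>g x. ()" "UNIV :: unit set" by unfold_locales auto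
  let ?B = "bar_boundaries G q" and ?f = "frag_map (map phi)"
  have diff: "a - b \<in> ?B" if ab: "a \<in> ?B" "b \<in> ?B" for a b
  proof -
    obtain a' b' where "a = bar_boundary G (Suc q) a'" "a' \<in> carrier (bar_chain_group G (Suc q))"
      "b = bar_boundary G (Suc q) b'" "b' \<in> carrier (bar_chain_group G (Suc q))"
      using ab by (auto simp: bar_boundaries_def)
    moreover from this have "a' - b' \<in> carrier (bar_chain_group G (Suc q))"
      using keys_diff[of a' b'] by (auto simp: bar_chain_group_def)
    ultimately show ?thesis by (auto simp: bar_boundaries_def bar_boundary_linear(1)[symmetric])
  qed
  have zero: "0 \<in> ?B"
    by (auto simp: bar_boundaries_def bar_chain_group_def bar_boundary_linear intro!: image_eqI[of _ _ 0])
  have add: "a + b \<in> ?B" if "a \<in> ?B" "b \<in> ?B" for a b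
    using diff[OF that(1) diff[OF zero that(2)]] by simp
  \<comment> \<open>Boundaries being cycles, \<open>triv\<close> applies to them and shows that
    \<open>?f\<close> maps \<open>?B\<close> into itself.\<close>
  have cyc: "b \<in> bar_cycles G q" if "b \<in> ?B" for b
  proof -
    obtain c where c: "b = bar_boundary G (Suc q) c" "c \<in> carrier (bar_chain_group G (Suc q))"
      using \<open>b \<in> ?B\<close> by (auto simp: bar_boundaries_def)
    define c' where "c' = attach () c"
    have c': "c' \<in> P.chains UNIV (Suc q)" unfolding c'_def by (rule P.attach_chains[OF c(2)]) simp
    have b: "b = forget (P.bd c')" using P.forget_bd[OF c'] c(1) by (simp add: c'_def forget_attach)
    have d: "P.bd c' \<in> P.chains UNIV q" by (rule P.bd_chains[OF P.stable_U c'])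
    show ?thesis using P.forget_carrier[OF d] P.forget_bd[OF d] P.bd_bd[OF c']
      by (simp add: b bar_cycles_def forget_simps)
  qed
  obtain z where z: "z \<in> bar_cycles G q" and Xz: "X = (\<lambda>b. b + z) ` ?B"
    using X by (auto simp: group_homology_def FactGroup_def RCOSETS_def r_coset_def bar_chain_group_def)
  define d where "d = ?f z - z"
  have d: "d \<in> ?B" unfolding d_def by (rule triv[OF z])
  have fb: "?f b \<in> ?B" if "b \<in> ?B" for b
    using add[OF triv[OF cyc[OF that]] that] by simp
  have "group_homology_induced G G q phi X = {b + ?f (b' + z) | b b'. b \<in> ?B \<and> b' \<in> ?B}"
    unfolding group_homology_induced_def Xz by (auto simp: set_mult_def bar_chain_group_def)
  also have "\<dots> = (\<lambda>b. b + z) ` ?B"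
  proof (intro equalityI subsetI)
    fix x assume "x \<in> {b + ?f (b' + z) | b b'. b \<in> ?B \<and> b' \<in> ?B}"
    then obtain b b' where b: "b \<in> ?B" "b' \<in> ?B" "x = b + ?f (b' + z)" by auto
    have "x = (b + ?f b' + d) + z" by (simp add: b d_def frag_extend_add)
    then show "x \<in> (\<lambda>b. b + z) ` ?B" using add[OF add[OF b(1) fb[OF b(2)]] d] by blast
  next
    fix x assume "x \<in> (\<lambda>b. b + z) ` ?B"
    then obtain b where b: "b \<in> ?B" "x = b + z" by auto
    have "x = (b - d) + ?f (0 + z)" by (simp add: b d_def)
    then show "x \<in> {b + ?f (b' + z) | b b'. b \<in> ?B \<and> b' \<in> ?B}" using diff[OF b(1) d] zero by blast
  qed
  finally show ?thesis using Xz by simp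
qed

section \<open>Conjugation by the reflection\<close>

context pythagorean_space
begin

lemma reflection_conj_hom:
  assumes "0 < n"
  shows "g \<in> carrier G \<Longrightarrow> reflection_conj n g \<in> carrier G"
    and "g \<in> carrier G \<Longrightarrow> h \<in> carrier G \<Longrightarrow>
      reflection_conj n (g \<otimes>\<^bsub>G\<^esub> h) = reflection_conj n g \<otimes>\<^bsub>G\<^esub> reflection_conj n h"
    and "g \<in> carrier G \<Longrightarrow> reflection_conj n g * refl0 = refl0 * g"
proof -
  note p = refl0_props[OF assms]
  have c: "g \<in> carrier_mat n n" if "g \<in> carrier G" for g using that by (simp add: carrier_G Orth_carrier)
  have det: "det (refl0 * g * refl0) = det g" if "g \<in> carrier_mat n n" for g
    using that p by (simp add: det_mult[of _ n])
  show "reflection_conj n g \<in> carrier G" if "g \<in> carrier G"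
    using that Orth_mult[OF Orth_mult[OF p(3)] p(3)] det[OF c[OF that]]
    unfolding carrier_G reflection_conj_eq[OF assms] by simp
  have *: "refl0 * (refl0 * h) = h" if "h \<in> carrier_mat n n" for h
    using p(1,2) that assoc_mult_mat[of refl0 n n refl0 n h n] by simp
  show "reflection_conj n (g \<otimes>\<^bsub>G\<^esub> h) = reflection_conj n g \<otimes>\<^bsub>G\<^esub> reflection_conj n h"
    if "g \<in> carrier G" "h \<in> carrier G"
    using p(1) c[OF that(1)] c[OF that(2)] *[of "h * refl0"]
    by (simp add: reflection_conj_eq[OF assms] mult_G assoc_mult_mat[of _ n n _ n _ n])
  show "reflection_conj n g * refl0 = refl0 * g" if "g \<in> carrier G"
    using p(1,2) c[OF that] by (simp add: reflection_conj_eq[OF assms] assoc_mult_mat[of _ n n _ n _ n])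
qed

lemma T_0: "T 0 = {[]}"
  by (auto simp: T_def)

lemma reflection_conj_trivial:
  assumes "2 * i < n" and z: "z \<in> bar_cycles G i"
  shows "frag_map (map (reflection_conj n)) z - z \<in> bar_boundaries G i"
proof -
  have n: "0 < n" using assms(1) by simp
  note p = refl0_props[OF n] and h = reflection_conj_hom[OF n]
  have c: "g \<in> carrier_mat n n" if "g \<in> carrier G" for g using that by (simp add: carrier_G Orth_carrier)
  \<comment> \<open>\<open>T 0\<close> contains only the empty tuple, which the group fixes, so
    \<open>z\<close> becomes a cycle on \<open>T 0\<close>.\<close>
  have zc: "attach [] z \<in> frames.chains (T 0) i" "frames.bd (attach [] z) = 0"
    using z frames.stable_T[of 0] frames.attach_chains frames.bd_attach
    by (auto simp: T_0 bar_cycles_def)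
  show ?thesis
  proof (cases "2 * i + 2 \<le> n")
    case True
    then have "frames.surj_at i 0" using frames.stability[of i] by simp
    then obtain y where y: "y \<in> frames.chains (Tp 0) i" "frames.bd y = 0" "map_point tl y = attach [] z"
      using zc unfolding frames.surj_at_def by blast
    have "forget y = z" using forget_map_point[of tl y] y(3) by (simp add: forget_attach)
    moreover have "frag_map (map (reflection_conj n)) (forget y) - forget y \<in> bar_boundaries G i"
    proof (rule frames.conjugation_boundary[OF frames.stable_Tp _ h(1,2) _ y(1,2)])
      fix t assume "t \<in> Tp 0"
      then obtain w where w: "t = [w]" "w \<in> V" "w \<bullet> w = 1" by (auto simp: Tp_def T_0)
      have rw: "refl_mat w \<in> carrier_mat n n" using w refl_mat_carrier by auto
      \<comment> \<open>Both factors have determinant \<open>-1\<close>.\<close>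
      show "refl0 * refl_mat (hd t) \<in> carrier G"
        unfolding p(5) using w n by (intro refl_mat_prod_G) auto
      fix g assume g: "g \<in> carrier G"
      have O: "g \<in> Orth" using g by (simp add: carrier_G)
      have "refl0 * refl_mat (g *\<^sub>v w) * g = refl0 * (g * refl_mat w)"
        using Orth_refl_mat[OF O w(2)] p(1) c[OF g] refl_mat_carrier[OF Orth_vec[OF O w(2)]]
        by (simp add: assoc_mult_mat[of _ n n _ n _ n])
      also have "\<dots> = reflection_conj n g * refl0 * refl_mat w"
        unfolding h(3)[OF g] using p(1) c[OF g] rw by (simp add: assoc_mult_mat[of _ n n _ n _ n])
      also have "\<dots> = reflection_conj n g * (refl0 * refl_mat w)"
        using c[OF h(1)[OF g]] p(1) rw by (simp add: assoc_mult_mat[of _ n n _ n _ n])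
      finally show "refl0 * refl_mat (hd (map ((*\<^sub>v) g) t)) \<otimes>\<^bsub>G\<^esub> g
          = reflection_conj n g \<otimes>\<^bsub>G\<^esub> (refl0 * refl_mat (hd t))"
        by (simp add: w mult_G)
    qed
    ultimately show ?thesis by simp
  next
    case False
    \<comment> \<open>Here \<open>n\<close> lies strictly between \<open>2 * i\<close> and
      \<open>2 * i + 2\<close>.\<close>
    then have odd: "odd n" using assms(1) by presburger
    \<comment> \<open>The sign does not affect conjugation but, \<open>n\<close> being odd, makes
      the determinant \<open>1\<close>.\<close>
    define s where "s = (- 1) \<cdot>\<^sub>m refl0"
    have sc: "s \<in> carrier_mat n n" using p(1) by (simp add: s_def)
    have "s * s = 1\<^sub>m n"
    proof -
      have "s * s = (- 1) \<cdot>\<^sub>m ((- 1) \<cdot>\<^sub>m (refl0 * refl0))"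
        using p(1) by (simp add: s_def mult_smult_distrib[of _ n n _ n] mult_smult_assoc_mat[of _ n n _ n])
      then show ?thesis using p(2) by (auto intro: eq_matI)
    qed
    moreover have "(s *\<^sub>v x) \<bullet> (s *\<^sub>v x) = x \<bullet> x" if x: "x \<in> V" for x
    proof -
      have "s *\<^sub>v x = (- 1) \<cdot>\<^sub>v (refl0 *\<^sub>v x)"
        unfolding s_def using p(1) x by (intro eq_vecI) auto
      then show ?thesis using Orth_vec[OF p(3) x] Orth_scalar_prod[OF p(3) x x] by (simp add: ip_simps)
    qed
    ultimately have "s \<in> Orth" using sc by (auto simp: Orth_iff invertible_mat_def inverts_mat_def)
    moreover have "det s = 1" using p(1,4) odd by (simp add: s_def)
    ultimately have sG: "s \<in> carrier G" by (simp add: carrier_G)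
    have "frag_map (map (reflection_conj n)) (forget (attach ([] :: 'a vec list) z)) -
        forget (attach ([] :: 'a vec list) z) \<in> bar_boundaries G i"
    proof (rule frames.conjugation_boundary[where s = "\<lambda>_. s", OF frames.stable_T _ h(1,2) _ zc])
      fix g assume g: "g \<in> carrier G"
      have "s * g = (- 1) \<cdot>\<^sub>m (reflection_conj n g * refl0)"
        unfolding h(3)[OF g] s_def using p(1) c[OF g] by (simp add: mult_smult_assoc_mat[of _ n n _ n])
      also have "\<dots> = reflection_conj n g * s"
        unfolding s_def using p(1) c[OF h(1)[OF g]] by (simp add: mult_smult_distrib[of _ n n _ n])
      finally show "s \<otimes>\<^bsub>G\<^esub> g = reflection_conj n g \<otimes>\<^bsub>G\<^esub> s" by (simp add: mult_G)
    qed (simp add: sG)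
    then show ?thesis by (simp add: forget_attach)
  qed
qed

lemma sigma_trivial:
  assumes "2 * i < n" "X \<in> carrier (group_homology G i)"
  shows "sigma TYPE('a) n i X = X"
  unfolding sigma_def using assms
  by (intro monoid.induced_identity[OF monoid_G] reflection_conj_trivial)

end

theorem corollary1p4:
  fixes i n :: nat
  assumes "infinite (UNIV :: 'a::field set)"
    and "pythagorean_field TYPE('a)"
    and "CHAR('a) \<noteq> 2"
    and "2 * i < n"
  shows "group_homology (SO_group TYPE('a) n) i
    \<cong> invariant_part (group_homology (SO_group TYPE('a) n) i) (sigma TYPE('a) n i)"
proof -
  have "(2 :: 'a) \<noteq> 0"
  proof
    assume "(2 :: 'a) = 0"
    then have "CHAR('a) dvd 2" using of_nat_eq_0_iff_char_dvd[of 2, where 'a = 'a] by simp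
    then have "CHAR('a) \<le> 2" "CHAR('a) \<noteq> 0" by (auto dest: dvd_imp_le intro: ccontr)
    then show False using assms(3) CHAR_not_1[where 'a = 'a] by linarith
  qed
  then interpret pythagorean_space n "TYPE('a)"
    using assms by unfold_locales
  \<comment> \<open>The invariant part is the whole group, so the identity is an
    isomorphism.\<close>
  have "{X \<in> carrier (group_homology G i). sigma TYPE('a) n i X = X} = carrier (group_homology G i)"
    using sigma_trivial[OF assms(4)] by blast
  then show ?thesis by (simp add: invariant_part_def)
qed

end
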